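(* Let $X$ be an infinite compact $0$-dimensional Hausdorff space, and assume further that $X$ has a finite number of isolated points. If $C(X)$ is countably degree-$1$ saturated, then the Boolean algebra $CL(X)$ is countably saturated. Moreover, if $X$ has no isolated points, then countable degree-$1$ saturation and countable saturation coincide for $C(X)$ (that is, $C(X)$ is countably degree-$1$ saturated if and only if it is countably saturated).
   Context: $C(X)$ is the C*-algebra of continuous complex-valued functions on $X$; $CL(X)$ is the Boolean algebra of clopen subsets of $X$; a space is $0$-dimensional if it has a basis of clopen sets. For compact $K\subseteq\mathbb{R}$ and $\epsilon>0$, $(K)_\epsilon=\{x\in\mathbb{R} : d(x,K)<\epsilon\}$; $A_{\le1}$ is the closed unit ball of a C*-algebra $A$. Formulas (continuous logic) are built from norms $\|P(\bar x)\|$ of $*$-polynomials by applying continuous real functions and taking $\sup$ and $\inf$ over variables ranging over the closed unit ball; parameters from $A$ may be substituted for variables. For a collection $\Phi$ of formulas, $A$ is countably $\Phi$-saturated if for every sequence $(\phi_n)_{n\in\mathbb{N}}$ of formulas from $\Phi$ with parameters from $A_{\le 1}$, in variables $(x_k)_{k\in\mathbb{N}}$ (finitely many in each $\phi_n$), and every sequence $(K_n)$ of compact subsets of $\mathbb{R}$, the following are equivalent: (1) there is a sequence $\bar b=(b_k)_{k\in\mathbb{N}}$ in $A_{\le1}$ with $\phi_n^A(\bar b)\in K_n$ for all $n$; (2) for every $\epsilon>0$ and finite $\Delta\subset\mathbb{N}$ there is a sequence $\bar b=(b_k)_{k\in\mathbb{N}}$ in $A_{\le1}$ with $\phi_n^A(\bar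 b)\in(K_n)_\epsilon$ for all $n\in\Delta$. $A$ is countably saturated if this holds with $\Phi$ the set of all formulas, and countably degree-$1$ saturated if it holds with $\Phi$ the set of formulas $\|P(\bar x)\|$ where $P$ is a $*$-polynomial of degree $1$ (a finite sum of terms $ax_kb$, $ax_k^*b$, $a$, with $a,b$ in $A$ or scalars). A Boolean algebra $B$ is countably saturated if every finitely satisfiable countable type (with parameters from $B$) in the first-order language of Boolean algebras is realized in $B$. *)

theory Defs
  imports "HOL-Analysis.Analysis"
begin

section \<open>Unital C*-algebras\<close>

class cstar_algebra = banach + real_normed_algebra_1 +
  fixes scaleC :: "complex \<Rightarrow> 'a \<Rightarrow> 'a" (infixr \<open>*\<^sub>C\<close> 75)
    and star :: "'a \<Rightarrow> 'a"
  assumes scaleC_add_right: "c *\<^sub>C (x + y) = c *\<^sub>C x + c *\<^sub>C y"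
    and scaleC_add_left: "(c + d) *\<^sub>C x = c *\<^sub>C x + d *\<^sub>C x"
    and scaleC_scaleC: "c *\<^sub>C d *\<^sub>C x = (c * d) *\<^sub>C x"
    and scaleC_of_real: "complex_of_real r *\<^sub>C x = r *\<^sub>R x"
    and mult_scaleC_left: "(c *\<^sub>C x) * y = c *\<^sub>C (x * y)"
    and mult_scaleC_right: "x * (c *\<^sub>C y) = c *\<^sub>C (x * y)"
    and norm_scaleC: "norm (c *\<^sub>C x) = cmod c * norm x"
    and star_star: "star (star x) = x"
    and star_add: "star (x + y) = star x + star y"
    and star_scaleC: "star (c *\<^sub>C x) = cnj c *\<^sub>C star x"
    and star_mult: "star (x * y) = star y * star x"
    and norm_star_mult_self: "norm (star x * x) = (norm x)\<^sup>2"

lemma norm_star_le: "norm x \<le> norm (star x)" for x :: "'a::cstar_algebra"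
proof (cases "x = 0")
  case False
  have "norm x * norm x \<le> norm (star x) * norm x"
    using norm_mult_ineq[of "star x" x] unfolding norm_star_mult_self power2_eq_square .
  then show ?thesis using False by simp
qed simp

lemma norm_star: "norm (star x) = norm x" for x :: "'a::cstar_algebra"
  using norm_star_le[of x] norm_star_le[of "star x"] by (simp add: star_star)

instantiation complex :: cstar_algebra
begin

definition scaleC_complex :: "complex \<Rightarrow> complex \<Rightarrow> complex"
  where "scaleC_complex c z = c * z"

definition star_complex :: "complex \<Rightarrow> complex"
  where "star_complex = cnj"

instance
proof
  show "norm (star x * x) = (norm x)\<^sup>2" for x :: complex
    by (simp add: star_complex_def norm_mult power2_eq_square)
qed (auto simp: scaleC_complex_def star_complex_def algebra_simps norm_mult scaleR_conv_of_real)

end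


section \<open>The C*-algebra of bounded continuous functions\<close>

text \<open>
  On a compact space every continuous function is bounded, so for compact \<open>'x\<close> the type
  \<open>'x \<Rightarrow>\<^sub>C complex\<close> with the operations below is \<open>C(X)\<close>.
\<close>

(* The library has this instance only for metric domains. *)
instance bcontfun :: (topological_space, complete_space) complete_space
proof
  fix f :: "nat \<Rightarrow> ('a, 'b) bcontfun"
  assume "Cauchy f"
  then obtain g where "uniform_limit UNIV f g sequentially"
    using uniformly_convergent_eq_cauchy[of "\<lambda>_. True" f]
    unfolding Cauchy_def uniform_limit_sequentially_iff
    by (metis dist_fun_lt_imp_dist_val_lt)
  from uniform_limit_bcontfunE[OF this sequentially_bot]
  obtain l' where "g = apply_bcontfun l'" "f \<longlonglongrightarrow> l'" by metis
  then show "convergent f"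
    by (intro convergentI)
qed

instance bcontfun :: (topological_space, banach) banach ..

unbundle bcontfun.lifting

instantiation bcontfun :: (topological_space, cstar_algebra) cstar_algebra
begin

lift_definition one_bcontfun :: "'a \<Rightarrow>\<^sub>C 'b" is "\<lambda>_. 1"
  by (rule const_bcontfun)

lift_definition times_bcontfun :: "('a \<Rightarrow>\<^sub>C 'b) \<Rightarrow> ('a \<Rightarrow>\<^sub>C 'b) \<Rightarrow> 'a \<Rightarrow>\<^sub>C 'b"
  is "\<lambda>f g x. f x * g x"
proof -
  fix f g :: "'a \<Rightarrow> 'b" assume f: "f \<in> bcontfun" and g: "g \<in> bcontfun"
  obtain a b where "\<And>x. norm (f x) \<le> a" "\<And>x. norm (g x) \<le> b"
    using f g by (auto simp: bcontfun_def bounded_iff)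
  note ab = this
  have "norm (f x * g x) \<le> a * b" for x
    by (rule order_trans[OF norm_mult_ineq mult_mono'[OF ab]]) simp_all
  then show "(\<lambda>x. f x * g x) \<in> bcontfun"
    using f g by (intro bcontfun_normI) (auto simp: bcontfun_def intro!: continuous_intros)
qed

lift_definition scaleC_bcontfun :: "complex \<Rightarrow> ('a \<Rightarrow>\<^sub>C 'b) \<Rightarrow> 'a \<Rightarrow>\<^sub>C 'b"
  is "\<lambda>c f x. c *\<^sub>C f x"
proof -
  fix c and f :: "'a \<Rightarrow> 'b" assume f: "f \<in> bcontfun"
  obtain a where "\<And>x. norm (f x) \<le> a"
    using f by (auto simp: bcontfun_def bounded_iff)
  then have "norm (c *\<^sub>C f x) \<le> cmod c * a" for x
    by (simp add: norm_scaleC mult_left_mono)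
  moreover have "continuous_on UNIV (\<lambda>x. (c *\<^sub>C 1) * f x)"
    using f by (auto simp: bcontfun_def intro!: continuous_intros)
  then have "continuous_on UNIV (\<lambda>x. c *\<^sub>C f x)"
    by (simp add: mult_scaleC_left)
  ultimately show "(\<lambda>x. c *\<^sub>C f x) \<in> bcontfun"
    by (intro bcontfun_normI)
qed

lift_definition star_bcontfun :: "('a \<Rightarrow>\<^sub>C 'b) \<Rightarrow> 'a \<Rightarrow>\<^sub>C 'b" is "\<lambda>f x. star (f x)"
proof -
  fix f :: "'a \<Rightarrow> 'b" assume f: "f \<in> bcontfun"
  obtain a where "\<And>x. norm (f x) \<le> a"
    using f by (auto simp: bcontfun_def bounded_iff)
  then have "norm (star (f x)) \<le> a" for x
    by (simp add: norm_star)
  moreover have "bounded_linear (star :: 'b \<Rightarrow> 'b)"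
  proof (rule bounded_linear_intro[where K = 1])
    show "star (r *\<^sub>R x) = r *\<^sub>R star x" for r and x :: 'b
      using star_scaleC[of "complex_of_real r" x] by (simp add: scaleC_of_real)
  qed (simp_all add: star_add norm_star)
  then have "continuous_on UNIV (\<lambda>x. star (f x))"
    by (rule bounded_linear.continuous_on) (use f in \<open>simp add: bcontfun_def\<close>)
  ultimately show "(\<lambda>x. star (f x)) \<in> bcontfun"
    by (intro bcontfun_normI)
qed

instance
proof
  fix f g h :: "'a \<Rightarrow>\<^sub>C 'b" and c d :: complex and r :: real
  show "f * g * h = f * (g * h)" by transfer (simp add: mult.assoc)
  show "1 * f = f" "f * 1 = f" by (transfer, simp)+
  show "(f + g) * h = f * h + g * h" by transfer (simp add: distrib_right)
  show "f * (g + h) = f * g + f * h" by transfer (simp add: distrib_left)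
  show "(0 :: 'a \<Rightarrow>\<^sub>C 'b) \<noteq> 1" by transfer (simp add: fun_eq_iff)
  show "r *\<^sub>R f * g = r *\<^sub>R (f * g)" "f * r *\<^sub>R g = r *\<^sub>R (f * g)" by (transfer, simp)+
  have app: "(f * g) x = f x * g x" "(c *\<^sub>C f) x = c *\<^sub>C f x" "star f x = star (f x)"
    "(1 :: 'a \<Rightarrow>\<^sub>C 'b) x = 1" for f g :: "'a \<Rightarrow>\<^sub>C 'b" and c x by (transfer, rule refl)+
  show "norm (f * g) \<le> norm f * norm g"
    by (rule norm_bound, unfold app)
      (rule order_trans[OF norm_mult_ineq mult_mono'[OF norm_bounded norm_bounded]]; simp)
  have "norm (1 :: 'a \<Rightarrow>\<^sub>C 'b) \<le> 1" by (rule norm_bound) (simp add: app)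
  moreover have "1 \<le> norm (1 :: 'a \<Rightarrow>\<^sub>C 'b)" using norm_bounded[of "1 :: 'a \<Rightarrow>\<^sub>C 'b"] by (simp add: app)
  ultimately show "norm (1 :: 'a \<Rightarrow>\<^sub>C 'b) = 1" by simp
  show "c *\<^sub>C (f + g) = c *\<^sub>C f + c *\<^sub>C g" by transfer (simp add: scaleC_add_right)
  show "(c + d) *\<^sub>C f = c *\<^sub>C f + d *\<^sub>C f" by transfer (simp add: scaleC_add_left)
  show scale2: "c *\<^sub>C d *\<^sub>C f = (c * d) *\<^sub>C f" for c d and f :: "'a \<Rightarrow>\<^sub>C 'b"
    by transfer (simp add: scaleC_scaleC)
  show scale1: "complex_of_real r *\<^sub>C f = r *\<^sub>R f" for r and f :: "'a \<Rightarrow>\<^sub>C 'b"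
    by transfer (simp add: scaleC_of_real)
  show "(c *\<^sub>C f) * g = c *\<^sub>C (f * g)" by transfer (simp add: mult_scaleC_left)
  show "f * (c *\<^sub>C g) = c *\<^sub>C (f * g)" by transfer (simp add: mult_scaleC_right)
  have le: "norm (c *\<^sub>C f) \<le> cmod c * norm f" for c and f :: "'a \<Rightarrow>\<^sub>C 'b"
    by (rule norm_bound) (simp add: app norm_scaleC mult_left_mono norm_bounded)
  show "norm (c *\<^sub>C f) = cmod c * norm f"
  proof (cases "c = 0")
    case True
    then show ?thesis using le[of c f] by simp
  next
    case False
    have "inverse c *\<^sub>C c *\<^sub>C f = f"
      using False scale2[of "inverse c" c f] scale1[of 1 f] by simp
    then have "norm f \<le> cmod (inverse c) * norm (c *\<^sub>C f)"
      using le[of "inverse c" "c *\<^sub>C f"] by simp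
    then have "cmod c * norm f \<le> norm (c *\<^sub>C f)"
      using False by (simp add: norm_divide field_simps)
    then show ?thesis using le[of c f] by simp
  qed
  show "star (star f) = f" by transfer (simp add: star_star)
  show "star (f + g) = star f + star g" by transfer (simp add: star_add)
  show "star (c *\<^sub>C f) = cnj c *\<^sub>C star f" by transfer (simp add: star_scaleC)
  show "star (f * g) = star g * star f" by transfer (simp add: star_mult)
  show "norm (star f * f) = (norm f)\<^sup>2"
  proof (rule antisym)
    have "norm ((star f * f) x) \<le> (norm f)\<^sup>2" for x
      using norm_bounded[of f x] by (simp add: app norm_star_mult_self power_mono)
    then show "norm (star f * f) \<le> (norm f)\<^sup>2" by (rule norm_bound)
    have "norm (f x) \<le> sqrt (norm (star f * f))" for x
      using norm_bounded[of "star f * f" x]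
      by (simp add: app norm_star_mult_self real_le_rsqrt)
    then have "norm f \<le> sqrt (norm (star f * f))" by (rule norm_bound)
    then have "(norm f)\<^sup>2 \<le> (sqrt (norm (star f * f)))\<^sup>2"
      by (rule power_mono) simp
    then show "(norm f)\<^sup>2 \<le> norm (star f * f)" by simp
  qed
qed

end

lifting_update bcontfun.lifting
lifting_forget bcontfun.lifting


section \<open>Formulas of continuous logic and saturation\<close>

datatype 'a star_poly =
    PVar nat
  | PParam 'a
  | PScalar complex
  | PAdd "'a star_poly" "'a star_poly"
  | PMult "'a star_poly" "'a star_poly"
  | PStar "'a star_poly"

primrec poly_val :: "(nat \<Rightarrow> 'a::cstar_algebra) \<Rightarrow> 'a star_poly \<Rightarrow> 'a" where
  "poly_val v (PVar k) = v k"
| "poly_val v (PParam a) = a"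
| "poly_val v (PScalar c) = c *\<^sub>C 1"
| "poly_val v (PAdd p q) = poly_val v p + poly_val v q"
| "poly_val v (PMult p q) = poly_val v p * poly_val v q"
| "poly_val v (PStar p) = star (poly_val v p)"

text \<open>
  An \<open>m\<close>-ary connective is a continuous function on \<open>\<real>\<^sup>m\<close>. It is represented by a function on
  real sequences that is continuous for the product topology and is evaluated at the arguments
  padded with zeros: \<open>f\<close> on \<open>\<real>\<^sup>m\<close> is represented by its composition with the projection to the
  first \<open>m\<close> coordinates, and conversely restricting to sequences supported on the first \<open>m\<close>
  coordinates gives a continuous function on \<open>\<real>\<^sup>m\<close>.
\<close>

datatype 'a formula =
    FNorm "'a star_poly"
  | FConn "(nat \<Rightarrow> real) \<Rightarrow> real" "'a formula list"
  | FSup nat "'a formula"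
  | FInf nat "'a formula"

primrec formula_val :: "'a::cstar_algebra formula \<Rightarrow> (nat \<Rightarrow> 'a) \<Rightarrow> real" where
  "formula_val (FNorm p) = (\<lambda>v. norm (poly_val v p))"
| "formula_val (FConn f \<phi>s) =
    (\<lambda>v. f (\<lambda>i. if i < length \<phi>s then (map formula_val \<phi>s ! i) v else 0))"
| "formula_val (FSup k \<phi>) = (\<lambda>v. SUP a\<in>cball 0 1. formula_val \<phi> (v(k := a)))"
| "formula_val (FInf k \<phi>) = (\<lambda>v. INF a\<in>cball 0 1. formula_val \<phi> (v(k := a)))"

inductive_set formulas :: "'a::cstar_algebra formula set" where
  "set_star_poly p \<subseteq> cball 0 1 \<Longrightarrow> FNorm p \<in> formulas"
| "continuous_on UNIV f \<Longrightarrow> (\<And>\<phi>. \<phi> \<in> set \<phi>s \<Longrightarrow> \<phi> \<in> formulas) \<Longrightarrow> FConn f \<phi>s \<in> formulas"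
| "\<phi> \<in> formulas \<Longrightarrow> FSup k \<phi> \<in> formulas"
| "\<phi> \<in> formulas \<Longrightarrow> FInf k \<phi> \<in> formulas"

definition coefficients :: "'a star_poly set" where
  "coefficients = range PParam \<union> range PScalar"

inductive_set degree_1_polys :: "'a star_poly set" where
  "a \<in> coefficients \<Longrightarrow> a \<in> degree_1_polys"
| "a \<in> coefficients \<Longrightarrow> b \<in> coefficients \<Longrightarrow> PMult (PMult a (PVar k)) b \<in> degree_1_polys"
| "a \<in> coefficients \<Longrightarrow> b \<in> coefficients \<Longrightarrow> PMult (PMult a (PStar (PVar k))) b \<in> degree_1_polys"
| "p \<in> degree_1_polys \<Longrightarrow> q \<in> degree_1_polys \<Longrightarrow> PAdd p q \<in> degree_1_polys"

text \<open>
  The neighbourhood \<open>(K)\<^sub>\<epsilon>\<close>. It is not defined by \<open>infdist\<close>, for which \<open>infdist x {} = 0\<close>; here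
  the neighbourhood of the empty set is empty, in accordance with \<open>d(x, \<emptyset>) = \<infinity>\<close>.
\<close>

definition nbhd :: "real set \<Rightarrow> real \<Rightarrow> real set" where
  "nbhd K \<epsilon> = {x. \<exists>y\<in>K. dist x y < \<epsilon>}"

definition countably_saturated_for :: "'a::cstar_algebra formula set \<Rightarrow> bool" where
  "countably_saturated_for \<Phi> \<longleftrightarrow>
    (\<forall>(\<phi> :: nat \<Rightarrow> 'a formula) (K :: nat \<Rightarrow> real set).
      (\<forall>n. \<phi> n \<in> \<Phi>) \<longrightarrow> (\<forall>n. compact (K n)) \<longrightarrow>
      ((\<exists>b. (\<forall>k. b k \<in> cball 0 1) \<and> (\<forall>n. formula_val (\<phi> n) b \<in> K n)) \<longleftrightarrow>
       (\<forall>\<epsilon>>0. \<forall>\<Delta>. finite \<Delta> \<longrightarrow>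
          (\<exists>b. (\<forall>k. b k \<in> cball 0 1) \<and> (\<forall>n\<in>\<Delta>. formula_val (\<phi> n) b \<in> nbhd (K n) \<epsilon>)))))"

definition countably_saturated :: "'a::cstar_algebra itself \<Rightarrow> bool" where
  "countably_saturated _ \<longleftrightarrow> countably_saturated_for (formulas :: 'a formula set)"

text \<open>
  The coefficients of a degree-1 \<open>*\<close>-polynomial are arbitrary elements of the algebra, whereas
  parameters in \<^const>\<open>formulas\<close> lie in the closed unit ball. Since \<open>a = c *\<^sub>C a'\<close> with \<open>a'\<close> in
  the unit ball and \<^const>\<open>PScalar\<close> is unrestricted, this makes no difference to which
  functions are defined.
\<close>

definition countably_degree_1_saturated :: "'a::cstar_algebra itself \<Rightarrow> bool" where
  "countably_degree_1_saturated _ \<longleftrightarrow>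
    countably_saturated_for (FNorm ` degree_1_polys :: 'a formula set)"


section \<open>The Boolean algebra of clopen sets\<close>

definition clopen :: "'x::topological_space set \<Rightarrow> bool" where
  "clopen U \<longleftrightarrow> open U \<and> closed U"

typedef (overloaded) 'x clopens = "{U :: 'x::topological_space set. clopen U}"
  morphisms set_of_clopens Clopens
  by (rule exI[of _ "{}"]) (simp add: clopen_def)

setup_lifting type_definition_clopens

instantiation clopens :: (topological_space) boolean_algebra
begin

lift_definition bot_clopens :: "'a clopens" is "{}" by (simp add: clopen_def)
lift_definition top_clopens :: "'a clopens" is UNIV by (simp add: clopen_def)
lift_definition inf_clopens :: "'a clopens \<Rightarrow> 'a clopens \<Rightarrow> 'a clopens" is "(\<inter>)"
  by (auto simp: clopen_def)
lift_definition sup_clopens :: "'a clopens \<Rightarrow> 'a clopens \<Rightarrow> 'a clopens" is "(\<union>)"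
  by (auto simp: clopen_def)
lift_definition minus_clopens :: "'a clopens \<Rightarrow> 'a clopens \<Rightarrow> 'a clopens" is "(-)"
  by (auto simp: clopen_def)
lift_definition uminus_clopens :: "'a clopens \<Rightarrow> 'a clopens" is uminus
  by (auto simp: clopen_def)
lift_definition less_eq_clopens :: "'a clopens \<Rightarrow> 'a clopens \<Rightarrow> bool" is "(\<subseteq>)" .
lift_definition less_clopens :: "'a clopens \<Rightarrow> 'a clopens \<Rightarrow> bool" is "(\<subset>)" .

instance by standard (transfer, auto)+

end


section \<open>First-order logic of Boolean algebras\<close>

datatype 'b ba_term =
    BVar nat
  | BParam 'b
  | BBot
  | BTop
  | BMeet "'b ba_term" "'b ba_term"
  | BJoin "'b ba_term" "'b ba_term"
  | BCompl "'b ba_term"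

primrec ba_term_val :: "(nat \<Rightarrow> 'b::boolean_algebra) \<Rightarrow> 'b ba_term \<Rightarrow> 'b" where
  "ba_term_val v (BVar k) = v k"
| "ba_term_val v (BParam b) = b"
| "ba_term_val v BBot = bot"
| "ba_term_val v BTop = top"
| "ba_term_val v (BMeet s t) = inf (ba_term_val v s) (ba_term_val v t)"
| "ba_term_val v (BJoin s t) = sup (ba_term_val v s) (ba_term_val v t)"
| "ba_term_val v (BCompl t) = - ba_term_val v t"

datatype 'b ba_formula =
    BEq "'b ba_term" "'b ba_term"
  | BNeg "'b ba_formula"
  | BAnd "'b ba_formula" "'b ba_formula"
  | BOr "'b ba_formula" "'b ba_formula"
  | BEx nat "'b ba_formula"
  | BAll nat "'b ba_formula"

primrec ba_sat :: "'b::boolean_algebra ba_formula \<Rightarrow> (nat \<Rightarrow> 'b) \<Rightarrow> bool" where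
  "ba_sat (BEq s t) = (\<lambda>v. ba_term_val v s = ba_term_val v t)"
| "ba_sat (BNeg \<phi>) = (\<lambda>v. \<not> ba_sat \<phi> v)"
| "ba_sat (BAnd \<phi> \<psi>) = (\<lambda>v. ba_sat \<phi> v \<and> ba_sat \<psi> v)"
| "ba_sat (BOr \<phi> \<psi>) = (\<lambda>v. ba_sat \<phi> v \<or> ba_sat \<psi> v)"
| "ba_sat (BEx k \<phi>) = (\<lambda>v. \<exists>b. ba_sat \<phi> (v(k := b)))"
| "ba_sat (BAll k \<phi>) = (\<lambda>v. \<forall>b. ba_sat \<phi> (v(k := b)))"

text \<open>
  As for C*-algebras, a type may involve all the variables \<open>x\<^sub>0, x\<^sub>1, \<dots>\<close>. Types in finitely many
  variables are the special case in which only finitely many of them occur.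
\<close>

definition ba_countably_saturated :: "'b::boolean_algebra itself \<Rightarrow> bool" where
  "ba_countably_saturated _ \<longleftrightarrow>
    (\<forall>\<Sigma> :: 'b ba_formula set. countable \<Sigma> \<longrightarrow>
      (\<forall>\<Delta>\<subseteq>\<Sigma>. finite \<Delta> \<longrightarrow> (\<exists>v. \<forall>\<phi>\<in>\<Delta>. ba_sat \<phi> v)) \<longrightarrow>
      (\<exists>v. \<forall>\<phi>\<in>\<Sigma>. ba_sat \<phi> v))"


section \<open>Spaces\<close>

definition zero_dimensional :: "'x::topological_space itself \<Rightarrow> bool" where
  "zero_dimensional _ \<longleftrightarrow> (\<exists>\<B> :: 'x set set. topological_basis \<B> \<and> (\<forall>U\<in>\<B>. clopen U))"

definition isolated_points :: "'x::topological_space set" where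
  "isolated_points = {x. x isolated_in UNIV}"

end

theory Submission
  imports Defs
begin

text \<open>
  Both halves of the theorem rest on one observation: what a first-order formula about clopen sets,
  or a formula of continuous logic about functions, can say about a tuple is said by the joint range
  of the tuple. For clopen sets \<open>u\<^sub>i\<close> this is the set of membership patterns
  \<open>{i. x \<in> u\<^sub>i}\<close> of the points \<open>x\<close>; for functions \<open>f\<^sub>i\<close> it is the set of value tuples \<open>(f\<^sub>i x)\<^sub>i\<close>.

  That formulas see nothing else is a back-and-forth argument (\<open>extend_patterns\<close> and
  \<open>close_extend\<close>): if two tuples have the same, or nearly the same, joint range over finitely many
  indices, then a further entry of the first tuple is matched by a further entry of the second.
  Each nonempty clopen set in which a pattern of the second tuple is constant has to be divided among
  the finitely many patterns that extend it. A nonempty clopen set without isolated points can be divided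
  into any finite number of nonempty clopen pieces. If it contains an isolated point, the singletons
  of the isolated points, which are kept among the parameters, ensure that only one extended pattern is needed.

  Saturation is therefore a statement about realizing a limit of joint ranges exactly, with countably
  many parameters held fixed. For a single clopen set this is where degree-1 saturation enters
  (\<open>degree_1_saturation_limit\<close>). Let \<open>f\<close> be in the unit ball and \<open>C\<close> be clopen. Then
  \<open>\<parallel>1\<^sub>C + 1\<^sub>C f\<parallel> = 2\<close> says that \<open>f\<close> takes the value \<open>1\<close> on \<open>C\<close>, and \<open>\<parallel>1\<^sub>C + 1\<^sub>C f\<parallel> = 0\<close> says
  that \<open>f\<close> is constantly \<open>- 1\<close> on \<open>C\<close>; likewise with the signs exchanged. These are conditions of
  degree 1, and although nothing forces \<open>f\<close> to have values in \<open>{1, - 1}\<close>, any clopen set separating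
  \<open>{f = 1}\<close> from \<open>{f = - 1}\<close> meets exactly the prescribed cells \<open>C\<close>. Iterating this step over the
  variables, each time using the extension property to approximate the next set, realizes any
  limit of patterns (\<open>realize_patterns\<close>). This proves the saturation of the Boolean algebra.

  For \<open>C(X)\<close>, a function in the unit ball is coded by a sequence of clopen sets, the digits of its
  real and imaginary parts in a redundant expansion that admits locally constant digits
  (\<open>decode_expansion\<close>). Functions whose first digits have the same patterns have nearly the same
  joint range, so realizing patterns of digits realizes limits of joint ranges of functions
  (\<open>realize_functions\<close>). Conversely, the formulas of degree 1 are among all formulas up to rescaling
  their coefficients into the unit ball.
\<close>

section \<open>Locally constant maps\<close>

definition locally_constant :: "('x::topological_space \<Rightarrow> 'b) \<Rightarrow> bool" where
  "locally_constant f \<longleftrightarrow> (\<forall>A. open (f -` A))"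

lemma clopen_vimage_locally_constant: "clopen (f -` A)" if "locally_constant f"
proof -
  have "f -` (- A) = - (f -` A)" by auto
  then show ?thesis
    using that unfolding locally_constant_def clopen_def closed_def by metis
qed

lemma locally_constant_const: "locally_constant (\<lambda>_. c)"
  by (simp add: locally_constant_def vimage_const)

lemma locally_constant_compose: "locally_constant (\<lambda>x. g (f x))" if "locally_constant f"
  unfolding locally_constant_def
proof
  fix A
  have "(\<lambda>x. g (f x)) -` A = f -` (g -` A)" by auto
  then show "open ((\<lambda>x. g (f x)) -` A)" using that by (simp add: locally_constant_def)
qed

lemma locally_constant_glue:
  assumes "locally_constant q" "\<And>l. locally_constant (r l)"
  shows "locally_constant (\<lambda>x. r (q x) x)"
  unfolding locally_constant_def
proof
  fix A
  have "(\<lambda>x. r (q x) x) -` A = (\<Union>l. q -` {l} \<inter> r l -` A)" by auto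
  then show "open ((\<lambda>x. r (q x) x) -` A)"
    using assms by (simp add: locally_constant_def open_Int open_UN)
qed

lemma locally_constant_mem: "locally_constant (\<lambda>x. x \<in> U)" if "clopen U"
  unfolding locally_constant_def
proof
  fix A :: "bool set"
  have "(\<lambda>x. x \<in> U) -` A = (if True \<in> A then U else {}) \<union> (if False \<in> A then - U else {})"
  proof (rule set_eqI)
    show "x \<in> (\<lambda>x. x \<in> U) -` A \<longleftrightarrow>
        x \<in> (if True \<in> A then U else {}) \<union> (if False \<in> A then - U else {})" for x
      by (cases "x \<in> U") simp_all
  qed
  then show "open ((\<lambda>x. x \<in> U) -` A)" using that by (simp add: clopen_def open_Un open_Compl)
qed

lemma locally_constant_if:
  assumes "clopen U" "locally_constant f" "locally_constant g"
  shows "locally_constant (\<lambda>x. if x \<in> U then f x else g x)"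
proof -
  have "locally_constant (if b then f else g)" for b using assms by simp
  from locally_constant_glue[OF locally_constant_mem[OF assms(1)], of "\<lambda>b. if b then f else g", OF this]
  show ?thesis by (simp add: if_distribR)
qed

lemma continuous_locally_constant: "continuous_on UNIV f" if "locally_constant f"
  using that by (auto simp: locally_constant_def continuous_on_open_vimage)

section \<open>Membership patterns of families of sets\<close>

text \<open>
  For finite \<open>S\<close>, two points have the same pattern iff they lie in the same atom of the Boolean algebra generated by
  the sets \<open>u i\<close> with \<open>i \<in> S\<close>. Thus \<open>patterns S u\<close> below records which atoms are nonempty.
\<close>

definition pattern :: "'i set \<Rightarrow> ('i \<Rightarrow> 'x set) \<Rightarrow> 'x \<Rightarrow> 'i set" where
  "pattern S u x = {i \<in> S. x \<in> u i}"

abbreviation patterns :: "'i set \<Rightarrow> ('i \<Rightarrow> 'x set) \<Rightarrow> 'i set set" where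
  "patterns S u \<equiv> range (pattern S u)"

lemma locally_constant_pattern:
  assumes "finite S" "\<And>i. i \<in> S \<Longrightarrow> clopen (u i)"
  shows "locally_constant (pattern S u)"
  using assms
proof (induction S)
  case empty
  have "pattern {} u = (\<lambda>_. {})" by (simp add: pattern_def fun_eq_iff)
  then show ?case by (simp add: locally_constant_const)
next
  case (insert i S)
  have "pattern (insert i S) u = (\<lambda>x. if x \<in> u i then insert i (pattern S u x) else pattern S u x)"
    by (auto simp: pattern_def fun_eq_iff)
  moreover have lc: "locally_constant (pattern S u)" using insert by blast
  ultimately show ?case
    using locally_constant_if[OF _ locally_constant_compose[OF lc, of "insert i"] lc] insert by simp
qed

lemma patterns_restrict: "patterns T u = (\<lambda>A. A \<inter> T) ` patterns S u" if "T \<subseteq> S"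
proof -
  have "pattern T u = (\<lambda>x. pattern S u x \<inter> T)" using that by (auto simp: pattern_def fun_eq_iff)
  then show ?thesis by (simp add: image_image)
qed

lemma patterns_subset: "patterns T u = patterns T v" if "patterns S u = patterns S v" "T \<subseteq> S"
  using that by (simp add: patterns_restrict[OF that(2)])

lemma patterns_cong: "patterns S u = patterns S v" if "\<And>i. i \<in> S \<Longrightarrow> u i = v i"
proof -
  have "pattern S u = pattern S v" using that by (auto simp: pattern_def fun_eq_iff)
  then show ?thesis by simp
qed

text \<open>
  Adding one set \<open>W\<close> splits each atom into its parts inside and outside \<open>W\<close>, so the new patterns
  are determined by which old patterns occur inside and which occur outside.
\<close>

lemma patterns_insert_eq_iff:
  assumes "k \<notin> S"
  shows "patterns (insert k S) (v(k := W)) = patterns (insert k S) (v(k := W')) \<longleftrightarrow>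
    pattern S v ` W = pattern S v ` W' \<and> pattern S v ` (- W) = pattern S v ` (- W')"
proof -
  have split: "patterns (insert k S) (v(k := U)) =
      insert k ` pattern S v ` U \<union> pattern S v ` (- U)" for U
  proof -
    have "pattern (insert k S) (v(k := U)) x =
        (if x \<in> U then insert k (pattern S v x) else pattern S v x)" for x
      using assms by (auto simp: pattern_def)
    then show ?thesis by (force simp: image_iff)
  qed
  have no_k: "k \<notin> pattern S v x" for x using assms by (simp add: pattern_def)
  have 1: "pattern S v ` (- U) = {A \<in> patterns (insert k S) (v(k := U)). k \<notin> A}" for U
    unfolding split by (auto simp: no_k)
  have 2: "pattern S v ` U = (\<lambda>A. A - {k}) ` {A \<in> patterns (insert k S) (v(k := U)). k \<in> A}" for U
  proof -
    have "{A \<in> patterns (insert k S) (v(k := U)). k \<in> A} = insert k ` pattern S v ` U"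
      unfolding split by (auto simp: no_k)
    moreover have "insert k A - {k} = A" if "A \<in> pattern S v ` U" for A
      using that no_k by auto
    ultimately show ?thesis by (simp add: image_image)
  qed
  show ?thesis
  proof
    assume *: "patterns (insert k S) (v(k := W)) = patterns (insert k S) (v(k := W'))"
    show "pattern S v ` W = pattern S v ` W' \<and> pattern S v ` (- W) = pattern S v ` (- W')"
      unfolding 1 2[of W] 2[of W'] * by simp
  qed (unfold split, simp)
qed

section \<open>Compact zero-dimensional spaces\<close>

locale stone_space =
  fixes X :: "'x::t2_space itself"
  assumes compact_space: "compact (UNIV :: 'x set)"
    and zero_dim: "zero_dimensional TYPE('x)"
begin

lemma clopen_neighbourhood:
  fixes x :: 'x
  assumes "open V" "x \<in> V"
  obtains U where "clopen U" "x \<in> U" "U \<subseteq> V"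
proof -
  obtain \<B> :: "'x set set" where \<B>: "topological_basis \<B>" "\<forall>U\<in>\<B>. clopen U"
    using zero_dim unfolding zero_dimensional_def by blast
  obtain U where "U \<in> \<B>" "x \<in> U" "U \<subseteq> V"
    using topological_basisE[OF \<B>(1) assms] by blast
  then show ?thesis using that \<B>(2) by blast
qed

text \<open>
  By compactness finitely many clopen sets, on each of which the functions vary little, cover the
  space; mapping a point to the centre of the first of these sets that contains it gives a locally
  constant \<open>p\<close>. Sending points to points allows several functions to be approximated by one map.
\<close>

lemma locally_constant_refinement:
  fixes h :: "'i \<Rightarrow> 'x \<Rightarrow> 'm::metric_space"
  assumes "finite S" "\<And>i. i \<in> S \<Longrightarrow> continuous_on UNIV (h i)" "\<delta> > 0"
  obtains p :: "'x \<Rightarrow> 'x" where "locally_constant p" "finite (range p)"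
    "\<And>i x. i \<in> S \<Longrightarrow> dist (h i x) (h i (p x)) < \<delta>"
proof -
  have "\<exists>U. clopen U \<and> x \<in> U \<and> (\<forall>y\<in>U. \<forall>i\<in>S. dist (h i y) (h i x) < \<delta>)" for x
  proof -
    let ?V = "\<Inter>i\<in>S. h i -` ball (h i x) \<delta>"
    have "open ?V" using assms(1,2) by (intro open_INT) (auto simp: continuous_on_open_vimage)
    moreover have "x \<in> ?V" using assms(3) by simp
    ultimately obtain U where "clopen U" "x \<in> U" "U \<subseteq> ?V" by (rule clopen_neighbourhood)
    then show ?thesis by (intro exI[of _ U]) (auto simp: dist_commute)
  qed
  then obtain B where B: "\<And>x. clopen (B x)" "\<And>x. x \<in> B x"
    "\<And>x y i. y \<in> B x \<Longrightarrow> i \<in> S \<Longrightarrow> dist (h i y) (h i x) < \<delta>" by metis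
  obtain F where F: "finite F" "UNIV \<subseteq> (\<Union>x\<in>F. B x)"
  proof (rule compactE_image[OF compact_space, of UNIV B])
    show "UNIV \<subseteq> (\<Union>x\<in>UNIV. B x)" using B(2) by blast
  qed (use B(1) in \<open>auto simp: clopen_def\<close>)
  have "\<exists>p. locally_constant p \<and> (\<forall>y \<in> (\<Union>x\<in>F. B x). p y \<in> F \<and> y \<in> B (p y))"
    using F(1)
  proof (induction F)
    case (insert x F)
    then obtain p where "locally_constant p" "\<forall>y \<in> (\<Union>x\<in>F. B x). p y \<in> F \<and> y \<in> B (p y)" by auto
    then show ?case
      by (intro exI[of _ "\<lambda>y. if y \<in> B x then x else p y"])
        (auto intro!: locally_constant_if locally_constant_const B)
  qed (auto intro: locally_constant_const)
  then obtain p where p: "locally_constant p" "\<And>y. p y \<in> F \<and> y \<in> B (p y)" using F(2) by blast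
  have "finite (range p)" using F(1) p(2) by (auto intro: finite_subset[of _ F])
  then show ?thesis using that p B(3) by blast
qed

text \<open>
  A nonempty clopen set without isolated points has two points, hence splits into two nonempty clopen
  parts, and so on by induction. This is the only place where isolated points are an obstruction.
\<close>

lemma onto_finite_set:
  fixes V :: "'x set"
  assumes "clopen V" "V \<noteq> {}" "finite J" "J \<noteq> {}"
    and "V \<inter> isolated_points = {} \<or> is_singleton J"
  shows "\<exists>r. locally_constant r \<and> r ` V = J"
  using assms(3,4,1,2,5)
proof (induction J arbitrary: V rule: finite_ne_induct)
  case (singleton j)
  then show ?case by (intro exI[of _ "\<lambda>_. j"]) (auto intro: locally_constant_const)
next
  case (insert j J)
  then have iso: "V \<inter> isolated_points = {}" by (auto simp: is_singleton_def)
  obtain x where x: "x \<in> V" using insert by auto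
  then have "\<not> x isolated_in UNIV" using iso by (auto simp: isolated_points_def)
  then have "V \<noteq> {x}" using \<open>clopen V\<close> by (auto simp: isolated_in_def clopen_def)
  then obtain y where y: "y \<in> V" "y \<noteq> x" using x by auto
  obtain U where U: "clopen U" "x \<in> U" "U \<subseteq> - {y}"
    using clopen_neighbourhood[of "- {y}" x] y by auto
  have "clopen (V - U)" using insert U by (auto simp: clopen_def)
  then obtain r where r: "locally_constant r" "r ` (V - U) = J"
    using insert.IH[of "V - U"] y U iso by auto
  have "(\<lambda>z. if z \<in> U then j else r z) ` V = insert j J"
    using r(2) x U by (auto simp: image_iff split: if_splits)
  then show ?case using locally_constant_if[OF U(1) locally_constant_const r(1)] by blast
qed

text \<open>
  The combinatorial core of both back-and-forth steps: here \<open>q\<close> is the old pattern of a point and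
  \<open>J\<close> gives the finitely many extended patterns that must all occur over it.
\<close>

lemma prescribed_fibre_images:
  fixes q :: "'x \<Rightarrow> 'l"
  assumes "locally_constant q" "\<And>y. finite (J (q y))" "\<And>y. J (q y) \<noteq> {}"
    and "\<And>y. y \<in> isolated_points \<Longrightarrow> is_singleton (J (q y))"
  obtains r where "locally_constant r" "\<And>y. r ` (q -` {q y}) = J (q y)"
proof -
  have "\<exists>r. locally_constant r \<and> (l \<in> range q \<longrightarrow> r ` (q -` {l}) = J l)" for l
  proof (cases "l \<in> range q")
    case True
    have "q -` {l} \<inter> isolated_points = {} \<or> is_singleton (J l)" using assms(4) by auto
    then show ?thesis
      using onto_finite_set[OF clopen_vimage_locally_constant[OF assms(1)], of "{l}" "J l"] True
        assms(2,3) by blast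
  qed (auto intro: locally_constant_const)
  then obtain r where r: "\<And>l. locally_constant (r l)" "\<And>l. l \<in> range q \<Longrightarrow> r l ` (q -` {l}) = J l"
    by metis
  have "(\<lambda>x. r (q x) x) ` (q -` {q y}) = r (q y) ` (q -` {q y})" for y by (intro image_cong) auto
  then show ?thesis using that[of "\<lambda>x. r (q x) x"] locally_constant_glue[where r = r, OF assms(1) r(1)] r(2) by simp
qed

text \<open>
  The back-and-forth step for clopen sets. If the singleton of an isolated point \<open>p\<close> occurs among the
  sets in both families, then the pattern of \<open>p\<close> is realized by \<open>p\<close> alone in both, hence
  has a unique extension.
\<close>

lemma extend_patterns:
  fixes u v :: "'i \<Rightarrow> 'x set"
  assumes "finite S" "k \<notin> S" "\<And>i. i \<in> S \<Longrightarrow> clopen (v i)"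
    and eq: "patterns S v = patterns S u"
    and iso: "\<And>p. p \<in> isolated_points \<Longrightarrow> \<exists>i\<in>S. v i = {p} \<and> u i = {p}"
  obtains W where "clopen W" "patterns (insert k S) (v(k := W)) = patterns (insert k S) u"
proof -
  define J where "J A = {B \<in> patterns (insert k S) u. B \<inter> S = A}" for A
  have pattern_Int: "pattern (insert k S) u x \<inter> S = pattern S u x" for x
    by (auto simp: pattern_def)
  have lc: "locally_constant (pattern S v)" using assms by (intro locally_constant_pattern)
  have fin: "finite (J A)" for A
    by (rule finite_subset[of _ "Pow (insert k S)"]) (auto simp: J_def pattern_def assms(1))
  have ne: "J (pattern S v y) \<noteq> {}" for y
  proof -
    obtain x where "pattern S v y = pattern S u x" using eq by blast
    then show ?thesis by (auto simp: J_def pattern_Int)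
  qed
  \<comment> \<open>An index whose set is the singleton of \<open>p\<close> in \<open>u\<close> forces every realization in \<open>u\<close> to be \<open>p\<close>.\<close>
  have single: "is_singleton (J (pattern S v p))" if p: "p \<in> isolated_points" for p
  proof (rule is_singletonI')
    fix B B' assume BB: "B \<in> J (pattern S v p)" "B' \<in> J (pattern S v p)"
    obtain i where i: "i \<in> S" "v i = {p}" "u i = {p}" using iso[OF p] by auto
    have "B = pattern (insert k S) u p" if "B \<in> J (pattern S v p)" for B
    proof -
      obtain x where x: "B = pattern (insert k S) u x" "pattern S u x = pattern S v p"
        using \<open>B \<in> J (pattern S v p)\<close> by (auto simp: J_def pattern_Int)
      have "i \<in> pattern S v p" using i by (simp add: pattern_def)
      then have "x = p" using x(2) i by (auto simp: pattern_def)
      then show ?thesis using x by simp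
    qed
    then show "B = B'" using BB by metis
  qed (rule ne)
  obtain r where r: "locally_constant r"
    "\<And>y. r ` (pattern S v -` {pattern S v y}) = J (pattern S v y)"
    using prescribed_fibre_images[of "pattern S v" J, OF lc fin ne single] by metis
  define W where "W = r -` {A. k \<in> A}"
  have rJ: "r y \<in> J (pattern S v y)" for y using r(2)[of y] by auto
  have pat: "pattern (insert k S) (v(k := W)) = r"
  proof
    fix y
    have "r y \<subseteq> insert k S" "r y \<inter> S = pattern S v y"
      using rJ[of y] by (auto simp: J_def pattern_def)
    then show "pattern (insert k S) (v(k := W)) y = r y"
      using assms(2) by (auto simp: pattern_def W_def)
  qed
  have "range r = patterns (insert k S) u"
  proof
    show "range r \<subseteq> patterns (insert k S) u" using rJ by (auto simp: J_def)
    show "patterns (insert k S) u \<subseteq> range r"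
    proof
      fix B assume B: "B \<in> patterns (insert k S) u"
      then have "B \<inter> S \<in> patterns S u" by (auto simp: pattern_Int)
      then obtain y where "B \<inter> S = pattern S v y" unfolding eq[symmetric] by blast
      then have "B \<in> J (pattern S v y)" using B by (simp add: J_def)
      then show "B \<in> range r" using r(2)[of y] by blast
    qed
  qed
  then show ?thesis
    using that[of W] clopen_vimage_locally_constant[OF r(1)] pat unfolding W_def by metis
qed

section \<open>Degree-1 saturation and a single clopen set\<close>

lemma finite_range_locally_constant:
  fixes q :: "'x \<Rightarrow> 'l"
  assumes "locally_constant q"
  shows "finite (range q)"
proof -
  obtain F where "finite F" "UNIV \<subseteq> (\<Union>l\<in>F. q -` {l})"
  proof (rule compactE_image[OF compact_space, of UNIV "\<lambda>l. q -` {l}"])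
    show "open (q -` {l})" for l using assms by (simp add: locally_constant_def)
  qed auto
  then have "range q \<subseteq> F" by blast
  then show ?thesis using \<open>finite F\<close> finite_subset by blast
qed

lemma bcontfun_of_continuous:
  fixes g :: "'x \<Rightarrow> complex"
  assumes "continuous_on UNIV g"
  obtains f where "apply_bcontfun f = g"
proof -
  have "bounded (range g)"
    using compact_continuous_image[OF assms compact_space] by (rule compact_imp_bounded)
  then have "g \<in> bcontfun" using assms by (simp add: bcontfun_def)
  then show ?thesis using that[of "Bcontfun g"] by (simp add: Bcontfun_inverse)
qed

lemma norm_attained:
  fixes f :: "'x \<Rightarrow>\<^sub>C complex"
  obtains x where "norm f = cmod (f x)"
proof -
  have "continuous_on UNIV (\<lambda>x. cmod (f x))" by (intro continuous_intros) auto
  then obtain x where x: "\<And>y. cmod (f y) \<le> cmod (f x)"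
    using continuous_attains_sup[OF compact_space, of "\<lambda>x. cmod (f x)"] by auto
  have "norm f = cmod (f x)"
    using x norm_bounded[of f x] by (intro antisym norm_bound)
  then show ?thesis using that by blast
qed

end

lemma bcontfun_apply:
  "apply_bcontfun (f + g) x = f x + g x"
  "apply_bcontfun (f * g) x = f x * g x"
  "apply_bcontfun (c *\<^sub>C f) x = c * f x"
  "apply_bcontfun (star f) x = cnj (f x)"
  "apply_bcontfun 1 x = 1"
  for f g :: "'a::topological_space \<Rightarrow>\<^sub>C complex"
  by (simp_all add: plus_bcontfun.rep_eq times_bcontfun.rep_eq scaleC_bcontfun.rep_eq
      star_bcontfun.rep_eq one_bcontfun.rep_eq scaleC_complex_def star_complex_def)

text \<open>
  Equality in the triangle inequality. It makes the norm of a degree-1 expression detect one single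
  value of a function in the unit ball.
\<close>

lemma eq_1_of_norm_1_plus:
  fixes w :: complex
  assumes "cmod w \<le> 1" "cmod (1 + w) = 2"
  shows "w = 1"
proof -
  have "(cmod w)\<^sup>2 \<le> 1" using assms(1) by (simp add: power_le_one)
  then have 1: "(Re w)\<^sup>2 + (Im w)\<^sup>2 \<le> 1" by (simp add: cmod_power2)
  have "(cmod (1 + w))\<^sup>2 = 4" using assms(2) by simp
  then have "(1 + Re w)\<^sup>2 + (Im w)\<^sup>2 = 4" by (simp add: cmod_power2)
  then have 2: "1 + 2 * Re w + (Re w)\<^sup>2 + (Im w)\<^sup>2 = 4" by (simp add: power2_eq_square algebra_simps)
  have ge: "Re w \<ge> 1" using 1 2 by linarith
  then have "(Re w)\<^sup>2 \<ge> 1" by simp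
  then have "(Im w)\<^sup>2 \<le> 0" "(Re w)\<^sup>2 \<le> 1\<^sup>2"
    using 1 zero_le_power2[of "Im w"] unfolding one_power2 by linarith+
  then have "Im w = 0" "Re w \<le> 1" using power2_le_imp_le[of "Re w" 1] by auto
  then show ?thesis using ge by (simp add: complex_eq_iff)
qed

context stone_space begin

text \<open>
  For \<open>g = 1\<^sub>C\<close>, the expression takes the value \<open>1 + \<sigma> f x\<close> on \<open>C\<close> and \<open>0\<close> elsewhere, and its norm
  is attained.
\<close>

lemma norm_detects_value:
  fixes f g :: "'x \<Rightarrow>\<^sub>C complex"
  assumes "\<And>x. g x = of_bool (x \<in> C)" "norm f \<le> 1" "\<sigma> = 1 \<or> \<sigma> = - 1"
  shows "norm (g + g * f * (\<sigma> *\<^sub>C 1)) = 2 \<longleftrightarrow> (\<exists>x\<in>C. f x = \<sigma>)"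
    and "norm (g + g * f * (\<sigma> *\<^sub>C 1)) = 0 \<longleftrightarrow> (\<forall>x\<in>C. f x = - \<sigma>)"
proof -
  let ?h = "g + g * f * (\<sigma> *\<^sub>C 1)"
  have h: "?h x = (if x \<in> C then 1 + \<sigma> * f x else 0)" for x
    by (simp add: bcontfun_apply assms(1))
  have sq: "\<sigma> * z = 1 \<longleftrightarrow> z = \<sigma>" "1 + \<sigma> * z = 0 \<longleftrightarrow> z = - \<sigma>" for z :: complex
  proof -
    have "- z = 1 \<longleftrightarrow> z = - 1" by (metis minus_minus)
    moreover have "1 + z = 0 \<longleftrightarrow> z = - 1" by (simp add: add_eq_0_iff)
    moreover have "1 - z = 0 \<longleftrightarrow> z = 1" by (metis right_minus_eq)
    ultimately show "\<sigma> * z = 1 \<longleftrightarrow> z = \<sigma>" "1 + \<sigma> * z = 0 \<longleftrightarrow> z = - \<sigma>"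
      using assms(3) by (elim disjE; simp)+
  qed
  have f1: "cmod (\<sigma> * f x) \<le> 1" for x
    using norm_bounded[of f x] assms(2,3) by (auto simp: norm_mult)
  have le: "cmod (?h x) \<le> 2" for x
    unfolding h using f1[of x] norm_triangle_ineq[of 1 "\<sigma> * f x"] by simp
  show "norm ?h = 2 \<longleftrightarrow> (\<exists>x\<in>C. f x = \<sigma>)"
  proof
    assume 2: "norm ?h = 2"
    obtain x where "norm ?h = cmod (?h x)" by (rule norm_attained)
    then have "x \<in> C" "cmod (1 + \<sigma> * f x) = 2" using 2 unfolding h by (auto split: if_splits)
    then show "\<exists>x\<in>C. f x = \<sigma>" using eq_1_of_norm_1_plus[OF f1] sq(1) by blast
  next
    assume "\<exists>x\<in>C. f x = \<sigma>"
    then obtain x where "x \<in> C" "\<sigma> * f x = 1" using sq(1) by blast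
    then have "?h x = 2" unfolding h by simp
    then have "2 \<le> norm ?h" using norm_bounded[of ?h x] by simp
    moreover have "norm ?h \<le> 2" by (rule norm_bound[OF le])
    ultimately show "norm ?h = 2" by simp
  qed
  have "norm ?h = 0 \<longleftrightarrow> (\<forall>x. ?h x = 0)"
    by (metis norm_eq_zero bcontfun_eqI zero_bcontfun.rep_eq)
  also have "\<dots> \<longleftrightarrow> (\<forall>x\<in>C. f x = - \<sigma>)" unfolding h using sq(2) by auto
  finally show "norm ?h = 0 \<longleftrightarrow> (\<forall>x\<in>C. f x = - \<sigma>)" .
qed

text \<open>
  Each fibre of each \<open>q n\<close> is to meet \<open>V\<close>, respectively its complement, exactly if it meets \<open>W n\<close>,
  respectively its complement. These are countably many conditions of degree 1 on a function \<open>f\<close>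
  (\<open>norm_detects_value\<close>), and any finite number of them is satisfied by \<open>1\<close> on \<open>W m\<close> and \<open>- 1\<close>
  off \<open>W m\<close> for large \<open>m\<close>, because the requirements are coherent.
\<close>

lemma degree_1_saturation_limit:
  fixes q :: "nat \<Rightarrow> 'x \<Rightarrow> 'l"
  assumes sat: "countably_degree_1_saturated TYPE('x \<Rightarrow>\<^sub>C complex)"
    and q: "\<And>n. locally_constant (q n)" and W: "\<And>n. clopen (W n)"
    and coherent: "\<And>m n. n \<le> m \<Longrightarrow> q n ` W m = q n ` W n"
      "\<And>m n. n \<le> m \<Longrightarrow> q n ` (- W m) = q n ` (- W n)"
  obtains V where "clopen V" "\<And>n. q n ` V = q n ` W n" "\<And>n. q n ` (- V) = q n ` (- W n)"
proof -
  have "\<exists>f :: 'x \<Rightarrow>\<^sub>C complex. \<forall>x. f x = of_bool (x \<in> U)" if "clopen U" for U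
  proof -
    have "continuous_on UNIV (\<lambda>x. of_bool (x \<in> U) :: complex)"
      by (intro continuous_locally_constant locally_constant_compose[where g = of_bool]
          locally_constant_mem that)
    then show ?thesis by (metis bcontfun_of_continuous)
  qed
  then obtain ind :: "'x set \<Rightarrow> 'x \<Rightarrow>\<^sub>C complex"
    where ind: "\<And>U x. clopen U \<Longrightarrow> ind U x = of_bool (x \<in> U)" by metis
  define \<sigma> :: "bool \<Rightarrow> complex" where "\<sigma> s = (if s then 1 else - 1)" for s
  have \<sigma>: "\<sigma> s = 1 \<or> \<sigma> s = - 1" "- \<sigma> s = \<sigma> (\<not> s)" "\<sigma> s = \<sigma> t \<longleftrightarrow> s = t" for s t
    by (auto simp: \<sigma>_def)
  define cell where "cell n l = q n -` {l}" for n l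
  have cell: "clopen (cell n l)" for n l
    unfolding cell_def by (intro clopen_vimage_locally_constant q)
  define P where "P = (\<lambda>(n, l, s). PAdd (PParam (ind (cell n l)))
    (PMult (PMult (PParam (ind (cell n l))) (PVar 0)) (PScalar (\<sigma> s))))"
  define K where "K = (\<lambda>(n, l, s). if \<exists>x\<in>cell n l. x \<in> W n \<longleftrightarrow> s then {2} else {0 :: real})"
  define I where "I = (SIGMA n:(UNIV :: nat set). range (q n) \<times> (UNIV :: bool set))"
  have I: "countable I" "I \<noteq> {}"
  proof -
    show "countable I"
      unfolding I_def
      by (intro countable_SIGMA countableI_type countable_finite finite_range_locally_constant q)
    show "I \<noteq> {}" unfolding I_def by blast
  qed
  have detect: "norm (poly_val b (P (n, l, s))) = 2 \<longleftrightarrow> (\<exists>x\<in>cell n l. b 0 x = \<sigma> s)"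
    "norm (poly_val b (P (n, l, s))) = 0 \<longleftrightarrow> (\<forall>x\<in>cell n l. b 0 x = \<sigma> (\<not> s))"
    if "b 0 \<in> cball 0 1" for b n l s
    using norm_detects_value[of "ind (cell n l)" "cell n l" "b 0" "\<sigma> s", OF ind[OF cell]] that \<sigma>(1)[of s]
    unfolding \<sigma>(2) by (simp_all add: P_def)
  have in_K: "norm (poly_val b (P (n, l, s))) \<in> K (n, l, s) \<longleftrightarrow>
     (if \<exists>x\<in>cell n l. x \<in> W n \<longleftrightarrow> s then \<exists>x\<in>cell n l. b 0 x = \<sigma> s
      else \<forall>x\<in>cell n l. b 0 x = \<sigma> (\<not> s))" if "b 0 \<in> cball 0 1" for b n l s
    using detect[of b, OF that] by (simp add: K_def del: norm_eq_zero)
  have "\<exists>b. (\<forall>k. b k \<in> cball 0 1) \<and> (\<forall>j. formula_val (FNorm (P (from_nat_into I j))) b \<in> K (from_nat_into I j))"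
  proof -
    have deg: "FNorm (P i) \<in> FNorm ` degree_1_polys" for i
    proof (cases i)
      case (fields n l s)
      show ?thesis unfolding fields P_def prod.case
        by (intro imageI degree_1_polys.intros) (simp_all add: coefficients_def)
    qed
    have cpt: "compact (K i)" for i by (cases i) (simp add: K_def)
    have "\<exists>b. (\<forall>k. b k \<in> cball 0 1) \<and>
        (\<forall>j\<in>\<Delta>. formula_val (FNorm (P (from_nat_into I j))) b \<in> nbhd (K (from_nat_into I j)) \<epsilon>)"
      if "\<epsilon> > 0" "finite \<Delta>" for \<epsilon> and \<Delta> :: "nat set"
    proof -
      define N where "N = Max (insert 0 ((\<lambda>j. fst (from_nat_into I j)) ` \<Delta>))"
      have N: "fst (from_nat_into I j) \<le> N" if "j \<in> \<Delta>" for j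
        using that \<open>finite \<Delta>\<close> by (auto simp: N_def)
      have "continuous_on UNIV (\<lambda>x. \<sigma> (x \<in> W N))"
        by (intro continuous_locally_constant locally_constant_compose[where g = \<sigma>]
          locally_constant_mem W)
      then obtain g :: "'x \<Rightarrow>\<^sub>C complex" where g: "\<And>x. g x = \<sigma> (x \<in> W N)"
        using bcontfun_of_continuous by metis
      have "norm g \<le> 1" by (rule norm_bound) (simp add: g \<sigma>_def)
      have "norm (poly_val (\<lambda>_. g) (P i)) \<in> K i" if "fst i \<le> N" for i
      proof (cases i)
        case (fields n l s)
        have n: "n \<le> N" using that fields by simp
        have "(\<exists>x\<in>cell n l. x \<in> W n \<longleftrightarrow> s) \<longleftrightarrow> (\<exists>x\<in>cell n l. x \<in> W N \<longleftrightarrow> s)"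
        proof (cases s)
          case True
          have "l \<in> q n ` W n \<longleftrightarrow> l \<in> q n ` W N" using coherent(1)[OF n] by simp
          then show ?thesis using True by (auto simp: cell_def image_iff)
        next
          case False
          have "l \<in> q n ` (- W n) \<longleftrightarrow> l \<in> q n ` (- W N)" using coherent(2)[OF n] by simp
          then show ?thesis using False by (auto simp: cell_def image_iff)
        qed
        then show ?thesis
          unfolding fields using in_K[of "\<lambda>_. g" n l s] \<open>norm g \<le> 1\<close> by (auto simp: g \<sigma>(3))
      qed
      moreover have "K i \<subseteq> nbhd (K i) \<epsilon>" for i
        using \<open>\<epsilon> > 0\<close> unfolding nbhd_def by (metis (mono_tags, lifting) dist_self mem_Collect_eq subsetI)
      ultimately have "norm (poly_val (\<lambda>_. g) (P (from_nat_into I j))) \<in> nbhd (K (from_nat_into I j)) \<epsilon>"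
        if "j \<in> \<Delta>" for j
        using N[OF that] by blast
      then show ?thesis using \<open>norm g \<le> 1\<close> by (intro exI[of _ "\<lambda>_. g"]) simp
    qed
    then show ?thesis
      using sat[unfolded countably_degree_1_saturated_def countably_saturated_for_def, rule_format,
          of "\<lambda>j. FNorm (P (from_nat_into I j))" "\<lambda>j. K (from_nat_into I j)"] deg cpt by simp
  qed
  then obtain b where b: "b 0 \<in> cball 0 1" and
    "\<And>j. formula_val (FNorm (P (from_nat_into I j))) b \<in> K (from_nat_into I j)" by blast
  then have "norm (poly_val b (P i)) \<in> K i" if "i \<in> I" for i
    using from_nat_into_surj[OF I(1) that] by auto
  then have b': "if \<exists>x\<in>cell n (q n y). x \<in> W n \<longleftrightarrow> s then \<exists>x\<in>cell n (q n y). b 0 x = \<sigma> s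
      else \<forall>x\<in>cell n (q n y). b 0 x = \<sigma> (\<not> s)" for n y s
    using in_K[of b, OF b, of n "q n y" s] by (simp add: I_def)
  \<comment> \<open>A locally constant approximation of the solution separates the values \<open>1\<close> and \<open>- 1\<close>.\<close>
  obtain p :: "'x \<Rightarrow> 'x" where p: "locally_constant p" "\<And>x. dist (b 0 x) (b 0 (p x)) < 1"
    using locally_constant_refinement[of "{()}" "\<lambda>_. apply_bcontfun (b 0)" 1] by auto
  define V where "V = p -` {x. 0 < Re (b 0 x)}"
  have V: "x \<in> V \<longleftrightarrow> s" if "b 0 x = \<sigma> s" for x s
    using p(2)[of x] abs_Re_le_cmod[of "b 0 x - b 0 (p x)"] that
    by (auto simp: V_def dist_norm \<sigma>_def split: if_splits)
  have same: "(\<exists>x\<in>cell n l. x \<in> V \<longleftrightarrow> s) \<longleftrightarrow> (\<exists>x\<in>cell n l. x \<in> W n \<longleftrightarrow> s)" for n l s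
  proof (cases "l \<in> range (q n)")
    case True
    then obtain y where l: "l = q n y" by blast
    show ?thesis
    proof (cases "\<exists>x\<in>cell n l. x \<in> W n \<longleftrightarrow> s")
      case True
      then obtain x where "x \<in> cell n l" "b 0 x = \<sigma> s" using b'[of n y s] l by auto
      then show ?thesis using True V[of x s] by blast
    next
      case False
      then have "\<forall>x\<in>cell n l. b 0 x = \<sigma> (\<not> s)" using b'[of n y s] l by auto
      then show ?thesis using False V[of _ "\<not> s"] by blast
    qed
  qed (auto simp: cell_def)
  have image_iff_cell: "l \<in> q n ` U \<longleftrightarrow> (\<exists>x\<in>cell n l. x \<in> U)" for n l U
    by (auto simp: cell_def)
  have "q n ` V = q n ` W n" for n
    using same[of n _ True] unfolding set_eq_iff image_iff_cell by simp
  moreover have "q n ` (- V) = q n ` (- W n)" for n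
    using same[of n _ False] unfolding set_eq_iff image_iff_cell by simp
  moreover have "clopen V" unfolding V_def by (rule clopen_vimage_locally_constant[OF p(1)])
  ultimately show ?thesis using that[of V] by blast
qed

end

section \<open>Realizing limits of patterns of clopen sets\<close>

text \<open>
  A diagonal argument: for each \<open>n\<close> the pigeonhole principle provides an infinite set of indices
  on which \<open>h n\<close> is constant, inside the set chosen before.
\<close>

lemma coherent_subsequence:
  fixes h :: "nat \<Rightarrow> nat \<Rightarrow> 'c"
  assumes "\<And>n. finite (range (h n))"
  obtains r where "\<And>n. n \<le> r n" "\<And>m n. n \<le> m \<Longrightarrow> h n (r m) = h n (r n)"
proof -
  have "\<exists>A. \<forall>n. infinite (A n) \<and> (A (Suc n) \<subseteq> A n \<and> (\<exists>c. \<forall>m\<in>A (Suc n). h n m = c))"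
  proof (rule dependent_nat_choice)
    show "\<exists>A :: nat set. infinite A" using infinite_UNIV_nat by blast
    fix A :: "nat set" and n assume A: "infinite A"
    have "finite (h n ` A)" using assms[of n] by (rule finite_subset[rotated]) auto
    then obtain a where "infinite {m \<in> A. h n m = h n a}" using pigeonhole_infinite[OF A] by blast
    then show "\<exists>B. infinite B \<and> (B \<subseteq> A \<and> (\<exists>c. \<forall>m\<in>B. h n m = c))"
      by (intro exI[of _ "{m \<in> A. h n m = h n a}"]) blast
  qed
  then obtain A c where A: "\<And>n. infinite (A n)" "\<And>n. A (Suc n) \<subseteq> A n"
    "\<And>n m. m \<in> A (Suc n) \<Longrightarrow> h n m = c n" by metis
  have "\<exists>m\<ge>n. m \<in> A (Suc n)" for n
    using A(1)[of "Suc n"] unfolding infinite_nat_iff_unbounded_le by blast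
  then obtain r where r: "\<And>n. n \<le> r n" "\<And>n. r n \<in> A (Suc n)" by metis
  have "A (Suc m) \<subseteq> A (Suc n)" if "n \<le> m" for m n
    using that by (rule lift_Suc_antimono_le[of "\<lambda>n. A (Suc n)", rotated]) (rule A(2))
  then have "h n (r m) = c n" if "n \<le> m" for m n
    using A(3) r(2) that by blast
  then have "h n (r m) = h n (r n)" if "n \<le> m" for m n using that by simp
  then show ?thesis using that r(1) by blast
qed

text \<open>
  Indices \<open>Inl i\<close> stand for parameters and indices \<open>Inr k\<close> for variables, so that a sequence \<open>\<alpha>\<close> of
  parameters and an assignment \<open>v\<close> form a single family \<open>case_sum \<alpha> v\<close>. The
  finite sets \<open>initial n\<close> exhaust the index type, so each formula involves only indices in one of them.
\<close>

definition initial :: "nat \<Rightarrow> (nat + nat) set" where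
  "initial n = Inl ` {..<n} \<union> Inr ` {..<n}"

lemma finite_initial: "finite (initial n)"
  by (simp add: initial_def)

lemma initial_mono: "m \<le> n \<Longrightarrow> initial m \<subseteq> initial n"
  by (auto simp: initial_def)

lemma patterns_initial_mono:
  "patterns (initial m) u = patterns (initial m) v"
  if "patterns (initial n) u = patterns (initial n) v" "m \<le> n"
  using patterns_subset[OF that(1) initial_mono[OF that(2)]] .

lemma singletons_indexed_below:
  fixes \<alpha> :: "nat \<Rightarrow> 'x set"
  assumes "finite P" "\<And>p. p \<in> P \<Longrightarrow> {p} \<in> range \<alpha>"
  obtains N where "\<And>p. p \<in> P \<Longrightarrow> \<exists>i<N. \<alpha> i = {p}"
proof -
  have "\<forall>p\<in>P. \<exists>i. \<alpha> i = {p}" using assms(2) by (metis imageE)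
  then obtain f where f: "\<And>p. p \<in> P \<Longrightarrow> \<alpha> (f p) = {p}" by metis
  obtain N where "\<And>p. p \<in> P \<Longrightarrow> f p < N"
    using finite_nat_set_iff_bounded[of "f ` P"] assms(1) by auto
  then show ?thesis using that[of N] f by blast
qed

context stone_space begin

text \<open>
  The sets \<open>v k\<close> are constructed one after the other. After \<open>k\<close> steps, all parameters together with
  the first \<open>k\<close> variables have the prescribed patterns. For each \<open>n\<close>, \<open>extend_patterns\<close> then
  provides a set that is correct as far as the first \<open>n\<close> indices are concerned, and
  \<open>degree_1_saturation_limit\<close> turns the sequence of these sets into one set that is correct for all \<open>n\<close>.
\<close>

lemma realize_coherent_patterns:
  fixes \<alpha> :: "nat \<Rightarrow> 'x set" and w :: "nat \<Rightarrow> nat \<Rightarrow> 'x set"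
  assumes sat: "countably_degree_1_saturated TYPE('x \<Rightarrow>\<^sub>C complex)"
    and fin: "finite (isolated_points :: 'x set)"
    and iso: "\<And>p. p \<in> isolated_points \<Longrightarrow> {p} \<in> range \<alpha>"
    and \<alpha>: "\<And>i. clopen (\<alpha> i)" and w: "\<And>m k. clopen (w m k)"
    and coherent: "\<And>m n. n \<le> m \<Longrightarrow>
      patterns (initial n) (case_sum \<alpha> (w m)) = patterns (initial n) (case_sum \<alpha> (w n))"
  obtains v where "\<And>k. clopen (v k)"
    "\<And>n. patterns (initial n) (case_sum \<alpha> v) = patterns (initial n) (case_sum \<alpha> (w n))"
proof -
  define M :: "nat \<Rightarrow> (nat + nat) set" where "M k = range Inl \<union> Inr ` {..<k}" for k
  have M_Suc: "M (Suc k) = insert (Inr k) (M k)" and M_k: "Inr k \<notin> M k" for k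
    by (auto simp: M_def lessThan_Suc)
  define Q where "Q k v \<longleftrightarrow> (\<forall>j. clopen (v j)) \<and> (\<forall>n. patterns (initial n \<inter> M k) (case_sum \<alpha> v) =
    patterns (initial n \<inter> M k) (case_sum \<alpha> (w n)))" for k v
  have upd: "case_sum \<alpha> (v(k := U)) = (case_sum \<alpha> v)(Inr k := U)" for v k U
    by (auto simp: fun_eq_iff split: sum.split)
  obtain N0 where N0: "\<And>p. p \<in> isolated_points \<Longrightarrow> \<exists>i<N0. \<alpha> i = {p}"
    using singletons_indexed_below[OF fin iso] by blast
  have step: "\<exists>W. Q (Suc k) (v(k := W))" if v: "Q k v" for k v
  proof -
    \<comment> \<open>Large enough to include the singletons of the isolated points and the variable \<open>k\<close> itself.\<close>
    define N where "N n = n + N0 + Suc k" for n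
    define S where "S n = initial (N n) \<inter> M k" for n
    have S: "finite (S n)" "Inr k \<notin> S n" "insert (Inr k) (S n) = initial (N n) \<inter> M (Suc k)" for n
      using M_k[of k] by (auto simp: S_def finite_initial M_Suc) (auto simp: initial_def N_def)
    have clop: "clopen (case_sum \<alpha> v i)" for i using v \<alpha> by (auto simp: Q_def split: sum.split)
    have "\<exists>W. clopen W \<and> patterns (insert (Inr k) (S n)) ((case_sum \<alpha> v)(Inr k := W)) =
        patterns (insert (Inr k) (S n)) (case_sum \<alpha> (w (N n)))" for n
    proof -
      have eq: "patterns (S n) (case_sum \<alpha> v) = patterns (S n) (case_sum \<alpha> (w (N n)))"
        using v by (simp add: Q_def S_def)
      have iso': "\<exists>i\<in>S n. case_sum \<alpha> v i = {p} \<and> case_sum \<alpha> (w (N n)) i = {p}"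
        if "p \<in> isolated_points" for p
      proof -
        obtain i where "i < N0" "\<alpha> i = {p}" using N0[OF \<open>p \<in> isolated_points\<close>] by blast
        then show ?thesis
          by (intro bexI[of _ "Inl i"]) (auto simp: S_def initial_def N_def M_def)
      qed
      obtain U where "clopen U" "patterns (insert (Inr k) (S n)) ((case_sum \<alpha> v)(Inr k := U)) =
        patterns (insert (Inr k) (S n)) (case_sum \<alpha> (w (N n)))"
        using extend_patterns[OF S(1,2) clop eq iso'] by blast
      then show ?thesis by blast
    qed
    then obtain W where W: "\<And>n. clopen (W n)"
      "\<And>n. patterns (insert (Inr k) (S n)) ((case_sum \<alpha> v)(Inr k := W n)) =
        patterns (insert (Inr k) (S n)) (case_sum \<alpha> (w (N n)))" by metis
    have "patterns (insert (Inr k) (S n)) ((case_sum \<alpha> v)(Inr k := W m)) =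
        patterns (insert (Inr k) (S n)) ((case_sum \<alpha> v)(Inr k := W n))" if "n \<le> m" for m n
    proof -
      have le: "N n \<le> N m" using that by (simp add: N_def)
      have "insert (Inr k) (S n) \<subseteq> insert (Inr k) (S m)"
        unfolding S(3) using initial_mono[OF le] by blast
      from patterns_subset[OF W(2) this]
      have "patterns (insert (Inr k) (S n)) ((case_sum \<alpha> v)(Inr k := W m)) =
        patterns (insert (Inr k) (S n)) (case_sum \<alpha> (w (N m)))" .
      also have "\<dots> = patterns (insert (Inr k) (S n)) (case_sum \<alpha> (w (N n)))"
        by (rule patterns_subset[OF coherent[OF le]]) (simp add: S(3))
      finally show ?thesis by (simp add: W(2))
    qed
    note images = this[unfolded patterns_insert_eq_iff[OF S(2)]]
    obtain V where V: "clopen V"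
      "\<And>n. pattern (S n) (case_sum \<alpha> v) ` V = pattern (S n) (case_sum \<alpha> v) ` W n"
      "\<And>n. pattern (S n) (case_sum \<alpha> v) ` (- V) = pattern (S n) (case_sum \<alpha> v) ` (- W n)"
      using degree_1_saturation_limit[of "\<lambda>n. pattern (S n) (case_sum \<alpha> v)" W, OF sat
          locally_constant_pattern[OF S(1) clop] W(1) images[THEN conjunct1] images[THEN conjunct2]]
      by blast
    have "patterns (initial n \<inter> M (Suc k)) (case_sum \<alpha> (v(k := V))) =
        patterns (initial n \<inter> M (Suc k)) (case_sum \<alpha> (w n))" for n
    proof -
      have le: "n \<le> N n" by (simp add: N_def)
      have "patterns (insert (Inr k) (S n)) (case_sum \<alpha> (v(k := V))) =
          patterns (insert (Inr k) (S n)) (case_sum \<alpha> (w (N n)))"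
        unfolding upd W(2)[symmetric] patterns_insert_eq_iff[OF S(2)] using V by simp
      then have "patterns (initial n \<inter> M (Suc k)) (case_sum \<alpha> (v(k := V))) =
          patterns (initial n \<inter> M (Suc k)) (case_sum \<alpha> (w (N n)))"
        by (rule patterns_subset) (use S(3) initial_mono[OF le] in blast)
      also have "\<dots> = patterns (initial n \<inter> M (Suc k)) (case_sum \<alpha> (w n))"
        by (rule patterns_subset[OF coherent[OF le]]) simp
      finally show ?thesis .
    qed
    then have "Q (Suc k) (v(k := V))" using v V(1) by (simp add: Q_def)
    then show ?thesis by blast
  qed
  have "\<exists>V. \<forall>k. Q k (V k) \<and> (\<exists>W. V (Suc k) = (V k)(k := W))"
  proof (rule dependent_nat_choice)
    have "patterns (initial n \<inter> M 0) (case_sum \<alpha> (w 0)) = patterns (initial n \<inter> M 0) (case_sum \<alpha> (w n))" for n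
      by (rule patterns_cong) (auto simp: M_def)
    then have "Q 0 (w 0)" using w by (simp add: Q_def)
    then show "\<exists>v. Q 0 v" by blast
    show "\<exists>v'. Q (Suc k) v' \<and> (\<exists>W. v' = v(k := W))" if "Q k v" for k v
      using step[OF that] by blast
  qed
  then obtain V where "\<forall>k. Q k (V k) \<and> (\<exists>W. V (Suc k) = (V k)(k := W))" ..
  then have V: "Q k (V k)" "\<exists>W. V (Suc k) = (V k)(k := W)" for k by simp_all
  define v where "v j = V (Suc j) j" for j
  have v: "V (Suc j + i) j = v j" for i j
  proof (induction i)
    case (Suc i)
    obtain W where "V (Suc (Suc j + i)) = (V (Suc j + i))(Suc j + i := W)" using V(2) by blast
    then show ?case using Suc by simp
  qed (simp add: v_def)
  have v_eq: "v j = V n j" if "j < n" for j n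
    using v[of j "n - Suc j"] that by simp
  have "patterns (initial n) (case_sum \<alpha> v) = patterns (initial n) (case_sum \<alpha> (w n))" for n
  proof -
    have "patterns (initial n) (case_sum \<alpha> v) = patterns (initial n) (case_sum \<alpha> (V n))"
      by (rule patterns_cong) (auto simp: initial_def v_eq)
    moreover have "initial n \<inter> M n = initial n" by (auto simp: initial_def M_def)
    ultimately show ?thesis using V(1)[of n] unfolding Q_def by metis
  qed
  moreover have "clopen (v j)" for j using V(1)[of "Suc j"] by (simp add: Q_def v_def)
  ultimately show ?thesis using that by blast
qed

lemma realize_patterns:
  fixes \<alpha> :: "nat \<Rightarrow> 'x set" and w :: "nat \<Rightarrow> nat \<Rightarrow> 'x set"
  assumes sat: "countably_degree_1_saturated TYPE('x \<Rightarrow>\<^sub>C complex)"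
    and fin: "finite (isolated_points :: 'x set)"
    and iso: "\<And>p. p \<in> isolated_points \<Longrightarrow> {p} \<in> range \<alpha>"
    and \<alpha>: "\<And>i. clopen (\<alpha> i)" and w: "\<And>m k. clopen (w m k)"
  obtains v where "\<And>k. clopen (v k)"
    "\<And>n. \<exists>m\<ge>n. patterns (initial n) (case_sum \<alpha> v) = patterns (initial n) (case_sum \<alpha> (w m))"
proof -
  have "finite (range (\<lambda>m. patterns (initial n) (case_sum \<alpha> (w m))))" for n
  proof (rule finite_subset)
    show "range (\<lambda>m. patterns (initial n) (case_sum \<alpha> (w m))) \<subseteq> Pow (Pow (initial n))"
      by (auto simp: pattern_def)
  qed (simp add: finite_initial)
  then obtain r where r: "\<And>n. n \<le> r n" "\<And>m n. n \<le> m \<Longrightarrow>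
     patterns (initial n) (case_sum \<alpha> (w (r m))) = patterns (initial n) (case_sum \<alpha> (w (r n)))"
    using coherent_subsequence[of "\<lambda>n m. patterns (initial n) (case_sum \<alpha> (w m))"] by metis
  obtain v where v: "\<And>k. clopen (v k)"
    "\<And>n. patterns (initial n) (case_sum \<alpha> v) = patterns (initial n) (case_sum \<alpha> (w (r n)))"
    using realize_coherent_patterns[of \<alpha> "\<lambda>m. w (r m)", OF sat fin iso \<alpha> w r(2)] by blast
  have "\<exists>m\<ge>n. patterns (initial n) (case_sum \<alpha> v) = patterns (initial n) (case_sum \<alpha> (w m))" for n
    using r(1)[of n] v(2)[of n] by (intro exI[of _ "r n"]) simp
  then show ?thesis by (rule that[OF v(1)])
qed

end

section \<open>First-order formulas about clopen sets\<close>

lemma pattern_subset: "pattern T u x = pattern T v y" if "pattern S u x = pattern S v y" "T \<subseteq> S"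
  using that by (auto simp: pattern_def)

abbreviation clopen_sets where
  "clopen_sets \<alpha> v \<equiv> case_sum (\<lambda>i. set_of_clopens (\<alpha> i)) (\<lambda>k. set_of_clopens (v k))"

lemma clopen_set_of_clopens: "clopen (set_of_clopens U)"
  using set_of_clopens[of U] by simp

lemma clopen_clopen_sets: "clopen (clopen_sets \<alpha> v i)"
  by (cases i) (simp_all add: clopen_set_of_clopens)

definition same_pattern ::
    "nat \<Rightarrow> (nat \<Rightarrow> 'x::topological_space clopens) \<Rightarrow> (nat \<Rightarrow> 'x clopens) \<Rightarrow> 'x \<Rightarrow> (nat \<Rightarrow> 'x clopens) \<Rightarrow> 'x \<Rightarrow> bool"
  where "same_pattern n \<alpha> v x w y \<longleftrightarrow>
    pattern (initial n) (clopen_sets \<alpha> v) x = pattern (initial n) (clopen_sets \<alpha> w) y"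

definition same_patterns ::
    "nat \<Rightarrow> (nat \<Rightarrow> 'x::topological_space clopens) \<Rightarrow> (nat \<Rightarrow> 'x clopens) \<Rightarrow> (nat \<Rightarrow> 'x clopens) \<Rightarrow> bool"
  where "same_patterns n \<alpha> v w \<longleftrightarrow>
    patterns (initial n) (clopen_sets \<alpha> v) = patterns (initial n) (clopen_sets \<alpha> w)"

lemma same_pattern_mono: "same_pattern n \<alpha> v x w y \<Longrightarrow> m \<le> n \<Longrightarrow> same_pattern m \<alpha> v x w y"
  unfolding same_pattern_def by (rule pattern_subset[OF _ initial_mono])

lemma same_patterns_mono: "same_patterns n \<alpha> v w \<Longrightarrow> m \<le> n \<Longrightarrow> same_patterns m \<alpha> v w"
  unfolding same_patterns_def by (rule patterns_initial_mono)

lemma same_patterns_sym: "same_patterns n \<alpha> v w \<Longrightarrow> same_patterns n \<alpha> w v"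
  unfolding same_patterns_def by (rule sym)

lemma same_patterns_obtain:
  assumes "same_patterns n \<alpha> v w"
  obtains x where "same_pattern n \<alpha> v x w y"
proof -
  have "pattern (initial n) (clopen_sets \<alpha> w) y \<in> patterns (initial n) (clopen_sets \<alpha> v)"
    using assms unfolding same_patterns_def by simp
  then obtain x where "pattern (initial n) (clopen_sets \<alpha> w) y = pattern (initial n) (clopen_sets \<alpha> v) x" ..
  then show ?thesis using that unfolding same_pattern_def by metis
qed

lemma same_patternD:
  assumes "same_pattern n \<alpha> v x w y" "i \<in> initial n"
  shows "x \<in> clopen_sets \<alpha> v i \<longleftrightarrow> y \<in> clopen_sets \<alpha> w i"
proof -
  have "i \<in> pattern (initial n) (clopen_sets \<alpha> v) x \<longleftrightarrow> i \<in> pattern (initial n) (clopen_sets \<alpha> w) y"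
    using assms(1) by (simp add: same_pattern_def)
  then show ?thesis using assms(2) by (simp add: pattern_def)
qed

lemma ba_term_val_depends_on_pattern:
  assumes "set_ba_term t \<subseteq> range \<alpha>"
  shows "\<exists>n. \<forall>v w x y. same_pattern n \<alpha> v x w y \<longrightarrow>
    (x \<in> set_of_clopens (ba_term_val v t) \<longleftrightarrow> y \<in> set_of_clopens (ba_term_val w t))"
    (is "\<exists>n. ?P n t")
  using assms
proof (induction t)
  have mono: "?P n t" if "?P m t" "m \<le> n" for m n t
    using that same_pattern_mono by blast
  {
    case (BVar k)
    have "Inr k \<in> initial (Suc k)" by (simp add: initial_def)
    from same_patternD[OF _ this, of \<alpha>] have "?P (Suc k) (BVar k)" by simp
    then show ?case by blast
  next
    case (BParam b)
    then obtain i where i: "b = \<alpha> i" by auto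
    have "Inl i \<in> initial (Suc i)" by (simp add: initial_def)
    from same_patternD[OF _ this, of \<alpha>] have "?P (Suc i) (BParam b)" by (simp add: i)
    then show ?case by blast
  next
    case (BMeet s t)
    then obtain m n where "?P m s" "?P n t" by auto
    from mono[OF this(1) max.cobounded1] mono[OF this(2) max.cobounded2]
    have "?P (max m n) (BMeet s t)" by (simp add: inf_clopens.rep_eq)
    then show ?case by blast
  next
    case (BJoin s t)
    then obtain m n where "?P m s" "?P n t" by auto
    from mono[OF this(1) max.cobounded1] mono[OF this(2) max.cobounded2]
    have "?P (max m n) (BJoin s t)" by (simp add: sup_clopens.rep_eq)
    then show ?case by blast
  next
    case (BCompl t)
    then obtain n where "?P n t" by auto
    then have "?P n (BCompl t)" by (simp add: uminus_clopens.rep_eq)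
    then show ?case by blast
  }
qed (simp_all add: bot_clopens.rep_eq top_clopens.rep_eq)

context stone_space begin

lemma extend_clopen_patterns:
  fixes \<alpha> :: "nat \<Rightarrow> 'x clopens"
  assumes "same_patterns n \<alpha> v w"
    and iso: "\<And>p. p \<in> isolated_points \<Longrightarrow> \<exists>i<n. set_of_clopens (\<alpha> i) = {p}"
    and "k < n"
  obtains c where "same_patterns n \<alpha> (v(k := b)) (w(k := c))"
proof -
  note eq = assms(1)[unfolded same_patterns_def]
  let ?S = "initial n - {Inr k}"
  have ins: "insert (Inr k) ?S = initial n" using \<open>k < n\<close> by (auto simp: initial_def)
  have upd: "clopen_sets \<alpha> (u(k := U)) = (clopen_sets \<alpha> u)(Inr k := set_of_clopens U)" for u U
    by (auto simp: fun_eq_iff split: sum.split)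
  have "patterns ?S (clopen_sets \<alpha> (v(k := b))) = patterns ?S (clopen_sets \<alpha> v)"
    by (rule patterns_cong) (simp add: upd)
  also have "\<dots> = patterns ?S (clopen_sets \<alpha> w)" by (rule patterns_subset[OF eq]) blast
  finally have eq': "patterns ?S (clopen_sets \<alpha> w) = patterns ?S (clopen_sets \<alpha> (v(k := b)))" ..
  have iso': "\<exists>i\<in>?S. clopen_sets \<alpha> w i = {p} \<and> clopen_sets \<alpha> (v(k := b)) i = {p}"
    if "p \<in> isolated_points" for p
  proof -
    obtain i where "i < n" "set_of_clopens (\<alpha> i) = {p}" using iso[OF \<open>p \<in> isolated_points\<close>] by blast
    then show ?thesis by (intro bexI[of _ "Inl i"]) (auto simp: initial_def)
  qed
  have fin: "finite ?S" and notin: "Inr k \<notin> ?S" by (simp_all add: finite_initial)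
  obtain W where W: "clopen W" "patterns (insert (Inr k) ?S) ((clopen_sets \<alpha> w)(Inr k := W)) =
      patterns (insert (Inr k) ?S) (clopen_sets \<alpha> (v(k := b)))"
    using extend_patterns[OF fin notin clopen_clopen_sets eq' iso'] by blast
  then have W': "set_of_clopens (Clopens W) = W" by (simp add: Clopens_inverse)
  have "same_patterns n \<alpha> (v(k := b)) (w(k := Clopens W))"
    unfolding same_patterns_def upd[of w] W' using W(2)[symmetric] unfolding ins .
  then show ?thesis by (rule that)
qed

text \<open>
  At an atomic formula this is clear pointwise. At a quantifier, \<open>extend_clopen_patterns\<close> transports a
  value of the bound variable from \<open>v\<close> to \<open>w\<close>, and back by symmetry.
\<close>

lemma ba_sat_depends_on_patterns:
  fixes \<alpha> :: "nat \<Rightarrow> 'x clopens"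
  assumes fin: "finite (isolated_points :: 'x set)"
    and iso: "\<And>p. p \<in> isolated_points \<Longrightarrow> {p} \<in> range (\<lambda>i. set_of_clopens (\<alpha> i))"
    and "set_ba_formula \<phi> \<subseteq> range \<alpha>"
  shows "\<exists>n. \<forall>v w. same_patterns n \<alpha> v w \<longrightarrow> ba_sat \<phi> v = ba_sat \<phi> w"
    (is "\<exists>n. ?P n \<phi>")
  using assms(3)
proof (induction \<phi>)
  have mono: "?P n \<phi>" if "?P m \<phi>" "m \<le> n" for m n \<phi>
    using that same_patterns_mono by blast
  obtain N where N: "\<And>p. p \<in> isolated_points \<Longrightarrow> \<exists>i<N. set_of_clopens (\<alpha> i) = {p}"
    using singletons_indexed_below[OF fin iso] by blast
  have quantifier: "\<exists>n. \<forall>v w. same_patterns n \<alpha> v w \<longrightarrow>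
    (\<forall>b. \<exists>c. ba_sat \<phi> (v(k := b)) = ba_sat \<phi> (w(k := c)))" if \<phi>: "?P m \<phi>" for m \<phi> k
  proof (rule exI[of _ "m + N + Suc k"], intro allI impI)
    fix v w b
    let ?n = "m + N + Suc k"
    assume *: "same_patterns ?n \<alpha> v w"
    have iso': "\<exists>i<?n. set_of_clopens (\<alpha> i) = {p}" if "p \<in> isolated_points" for p
      using N[OF \<open>p \<in> isolated_points\<close>] by (meson trans_less_add1 trans_less_add2)
    have "k < ?n" by simp
    then obtain c where "same_patterns ?n \<alpha> (v(k := b)) (w(k := c))"
      using extend_clopen_patterns[OF * iso'] by blast
    moreover have "m \<le> ?n" by simp
    ultimately show "\<exists>c. ba_sat \<phi> (v(k := b)) = ba_sat \<phi> (w(k := c))" using mono[OF \<phi>] by blast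
  qed
  {
    case (BEq s t)
    then obtain m n where
      m: "\<And>v w x y. same_pattern m \<alpha> v x w y \<Longrightarrow>
        (x \<in> set_of_clopens (ba_term_val v s) \<longleftrightarrow> y \<in> set_of_clopens (ba_term_val w s))" and
      n: "\<And>v w x y. same_pattern n \<alpha> v x w y \<Longrightarrow>
        (x \<in> set_of_clopens (ba_term_val v t) \<longleftrightarrow> y \<in> set_of_clopens (ba_term_val w t))"
      using ba_term_val_depends_on_pattern[of s \<alpha>] ba_term_val_depends_on_pattern[of t \<alpha>] by auto
    have imp: "ba_term_val w s = ba_term_val w t"
      if eq: "same_patterns (max m n) \<alpha> v w" and v: "ba_term_val v s = ba_term_val v t" for v w
    proof -
      have "y \<in> set_of_clopens (ba_term_val w s) \<longleftrightarrow> y \<in> set_of_clopens (ba_term_val w t)" for y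
      proof -
        obtain x where x: "same_pattern (max m n) \<alpha> v x w y" using same_patterns_obtain[OF eq] .
        show ?thesis
          using m[OF same_pattern_mono[OF x max.cobounded1]] n[OF same_pattern_mono[OF x max.cobounded2]]
            v by simp
      qed
      then have "set_of_clopens (ba_term_val w s) = set_of_clopens (ba_term_val w t)" by blast
      then show ?thesis by (simp only: set_of_clopens_inject)
    qed
    have "?P (max m n) (BEq s t)" using imp same_patterns_sym by (simp only: ba_sat.simps) blast
    then show ?case by blast
  next
    case (BNeg \<phi>)
    then show ?case by simp
  next
    case (BAnd \<phi> \<psi>)
    then obtain m n where "?P m \<phi>" "?P n \<psi>" by auto
    from mono[OF this(1) max.cobounded1] mono[OF this(2) max.cobounded2]
    have "?P (max m n) (BAnd \<phi> \<psi>)" by simp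
    then show ?case by blast
  next
    case (BOr \<phi> \<psi>)
    then obtain m n where "?P m \<phi>" "?P n \<psi>" by auto
    from mono[OF this(1) max.cobounded1] mono[OF this(2) max.cobounded2]
    have "?P (max m n) (BOr \<phi> \<psi>)" by simp
    then show ?case by blast
  next
    case (BEx k \<phi>)
    then obtain m where "?P m \<phi>" by auto
    then obtain n where n: "\<forall>v w. same_patterns n \<alpha> v w \<longrightarrow>
      (\<forall>b. \<exists>c. ba_sat \<phi> (v(k := b)) = ba_sat \<phi> (w(k := c)))" using quantifier by blast
    have "\<exists> c. ba_sat \<phi> (v(k := c))"
      if "same_patterns n \<alpha> v w" "\<exists> c. ba_sat \<phi> (w(k := c))" for v w
      using n that same_patterns_sym[of n \<alpha> v w] by blast
    then have "?P n (BEx k \<phi>)" using same_patterns_sym[of n \<alpha>] by (simp only: ba_sat.simps) blast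
    then show ?case by blast
  next
    case (BAll k \<phi>)
    then obtain m where "?P m \<phi>" by auto
    then obtain n where n: "\<forall>v w. same_patterns n \<alpha> v w \<longrightarrow>
      (\<forall>b. \<exists>c. ba_sat \<phi> (v(k := b)) = ba_sat \<phi> (w(k := c)))" using quantifier by blast
    have "\<forall> c. ba_sat \<phi> (v(k := c))"
      if "same_patterns n \<alpha> v w" "\<forall> c. ba_sat \<phi> (w(k := c))" for v w
      using n that same_patterns_sym[of n \<alpha> v w] by blast
    then have "?P n (BAll k \<phi>)" using same_patterns_sym[of n \<alpha>] by (simp only: ba_sat.simps) blast
    then show ?case by blast
  }
qed

text \<open>
  The singletons of the isolated points are added to the parameters of the type, as required by the
  back-and-forth step. Assignments \<open>w m\<close> satisfying larger and larger finite parts of the type have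
  patterns that are realized in the limit, and each formula of the type is controlled by finitely many of the
  patterns.
\<close>

lemma ba_countably_saturated_clopens:
  assumes sat: "countably_degree_1_saturated TYPE('x \<Rightarrow>\<^sub>C complex)"
    and fin: "finite (isolated_points :: 'x set)"
  shows "ba_countably_saturated TYPE('x clopens)"
  unfolding ba_countably_saturated_def
proof (intro allI impI)
  fix \<Sigma> :: "'x clopens ba_formula set"
  assume "countable \<Sigma>" and fs: "\<forall>\<Delta>\<subseteq>\<Sigma>. finite \<Delta> \<longrightarrow> (\<exists>v. \<forall>\<phi>\<in>\<Delta>. ba_sat \<phi> v)"
  define A where "A = insert bot (Clopens ` (\<lambda>p. {p}) ` isolated_points \<union> (\<Union>\<phi>\<in>\<Sigma>. set_ba_formula \<phi>))"
  have finite_params: "finite (set_ba_term t)" for t :: "'x clopens ba_term" by (induction t) auto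
  have "finite (set_ba_formula \<phi>)" for \<phi> :: "'x clopens ba_formula"
    by (induction \<phi>) (auto simp: finite_params)
  then have "countable A"
    unfolding A_def using \<open>countable \<Sigma>\<close> fin
    by (intro countable_insert countable_Un countable_image countable_UN) (simp_all add: countable_finite)
  define \<alpha> where "\<alpha> = from_nat_into A"
  have range_\<alpha>: "range \<alpha> = A"
    unfolding \<alpha>_def using \<open>countable A\<close> by (intro range_from_nat_into) (auto simp: A_def)
  have iso: "{p} \<in> range (\<lambda>i. set_of_clopens (\<alpha> i))" if "p \<in> isolated_points" for p
  proof -
    have "clopen {p}" using that by (auto simp: isolated_points_def isolated_in_def clopen_def)
    moreover have "Clopens {p} \<in> range \<alpha>" using that by (simp add: range_\<alpha> A_def)
    then have "set_of_clopens (Clopens {p}) \<in> range (\<lambda>i. set_of_clopens (\<alpha> i))" by (rule imageE) simp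
    ultimately show ?thesis by (simp add: Clopens_inverse)
  qed
  have "\<exists>v. \<forall>\<phi>\<in>\<Sigma>. to_nat_on \<Sigma> \<phi> \<le> m \<longrightarrow> ba_sat \<phi> v" for m
  proof -
    have "finite {\<phi> \<in> \<Sigma>. to_nat_on \<Sigma> \<phi> \<le> m}"
      using finite_vimage_IntI[OF finite_atMost[of m] inj_on_to_nat_on[OF \<open>countable \<Sigma>\<close>]]
      by (rule finite_subset[rotated]) auto
    with fs have "\<exists>v. \<forall>\<phi>\<in>{\<phi> \<in> \<Sigma>. to_nat_on \<Sigma> \<phi> \<le> m}. ba_sat \<phi> v" by blast
    then show ?thesis by blast
  qed
  then obtain w where w: "\<And>m \<phi>. \<phi> \<in> \<Sigma> \<Longrightarrow> to_nat_on \<Sigma> \<phi> \<le> m \<Longrightarrow> ba_sat \<phi> (w m)" by metis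
  obtain v where v: "\<And>k. clopen (v k)" "\<And>n. \<exists>m\<ge>n. patterns (initial n) (case_sum (\<lambda>i. set_of_clopens (\<alpha> i)) v) =
      patterns (initial n) (clopen_sets \<alpha> (w m))"
    using realize_patterns[of "\<lambda>i. set_of_clopens (\<alpha> i)" "\<lambda>m k. set_of_clopens (w m k)",
        OF sat fin iso clopen_set_of_clopens clopen_set_of_clopens] by blast
  define v' where "v' k = Clopens (v k)" for k
  have v': "clopen_sets \<alpha> v' = case_sum (\<lambda>i. set_of_clopens (\<alpha> i)) v"
    using v(1) by (simp add: v'_def Clopens_inverse)
  have "ba_sat \<phi> v'" if \<phi>: "\<phi> \<in> \<Sigma>" for \<phi>
  proof -
    have "set_ba_formula \<phi> \<subseteq> range \<alpha>" using \<phi> by (auto simp: range_\<alpha> A_def)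
    then obtain n where n: "\<And>v w. same_patterns n \<alpha> v w \<Longrightarrow> ba_sat \<phi> v = ba_sat \<phi> w"
      using ba_sat_depends_on_patterns[OF fin iso] by blast
    let ?n = "max n (to_nat_on \<Sigma> \<phi>)"
    obtain m where m: "?n \<le> m" "same_patterns ?n \<alpha> v' (w m)"
      using v(2)[of ?n] unfolding v'[symmetric] same_patterns_def by blast
    have "ba_sat \<phi> v' = ba_sat \<phi> (w m)" by (rule n[OF same_patterns_mono[OF m(2)]]) simp
    then show ?thesis using w[OF \<phi>] m(1) by simp
  qed
  then show "\<exists>v. \<forall>\<phi>\<in>\<Sigma>. ba_sat \<phi> v" by blast
qed

end

section \<open>Formulas of continuous logic depend on joint ranges\<close>

lemma common_bound:
  fixes l :: nat
  assumes "\<And>i. i < l \<Longrightarrow> \<exists>n::nat. P i n" "\<And>i m n. P i m \<Longrightarrow> m \<le> n \<Longrightarrow> P i n"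
  shows "\<exists>n. \<forall>i<l. P i n"
  using assms(1)
proof (induction l)
  case (Suc l)
  then obtain m n where "\<forall>i<l. P i m" "P l n" by (metis lessI less_SucI)
  then have "\<forall>i<Suc l. P i (max m n)"
    using assms(2) by (metis less_Suc_eq max.cobounded1 max.cobounded2)
  then show ?case ..
qed simp

lemma compact_box: "compact {g :: nat \<Rightarrow> real. \<forall>i. \<bar>g i\<bar> \<le> M i}"
proof -
  have "compactin (product_topology (\<lambda>i. euclidean :: real topology) UNIV) (PiE UNIV (\<lambda>i. {- M i..M i}))"
    by (subst compactin_PiE) simp
  moreover have "PiE UNIV (\<lambda>i. {- M i..M i}) = {g. \<forall>i. \<bar>g i\<bar> \<le> M i}"
    by (auto simp: PiE_def abs_le_iff minus_le_iff)
  ultimately show ?thesis by (simp add: euclidean_product_topology)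
qed

lemma connective_bounded:
  fixes f :: "(nat \<Rightarrow> real) \<Rightarrow> real"
  assumes "continuous_on UNIV f"
  obtains B where "\<And>g. (\<And>i. \<bar>g i\<bar> \<le> M i) \<Longrightarrow> \<bar>f g\<bar> \<le> B"
proof -
  have "bounded (f ` {g. \<forall>i. \<bar>g i\<bar> \<le> M i})"
    using compact_continuous_image[OF continuous_on_subset[OF assms subset_UNIV] compact_box]
    by (rule compact_imp_bounded)
  then obtain B where B: "\<And>y. y \<in> f ` {g. \<forall>i. \<bar>g i\<bar> \<le> M i} \<Longrightarrow> \<bar>y\<bar> \<le> B"
    by (auto simp: bounded_real)
  show ?thesis by (rule that, rule B) blast
qed

text \<open>
  The arguments of a connective are bounded, so they range over a product of compact intervals, on which a
  continuous function is uniformly continuous.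
\<close>

lemma connective_uniformly_continuous:
  fixes f :: "(nat \<Rightarrow> real) \<Rightarrow> real"
  assumes "continuous_on UNIV f" "\<eta> > 0"
  obtains \<delta> where "\<delta> > 0" "\<And>g h. (\<And>i. \<bar>g i\<bar> \<le> M i) \<Longrightarrow> (\<And>i. \<bar>h i\<bar> \<le> M i) \<Longrightarrow>
    (\<And>i. \<bar>g i - h i\<bar> \<le> \<delta>) \<Longrightarrow> \<bar>f g - f h\<bar> \<le> \<eta>"
proof -
  have "uniformly_continuous_on {g. \<forall>i. \<bar>g i\<bar> \<le> M i} f"
    by (rule compact_uniformly_continuous[OF continuous_on_subset[OF assms(1) subset_UNIV] compact_box])
  then obtain d where d: "d > 0" "\<forall>g\<in>{g. \<forall>i. \<bar>g i\<bar> \<le> M i}. \<forall>h\<in>{g. \<forall>i. \<bar>g i\<bar> \<le> M i}.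
      dist h g < d \<longrightarrow> dist (f h) (f g) < \<eta>"
    using assms(2) unfolding uniformly_continuous_on_def by blast
  have dist: "dist g h \<le> 2 * \<delta>" if "\<And>i. \<bar>g i - h i\<bar> \<le> \<delta>" for g h :: "nat \<Rightarrow> real" and \<delta>
  proof -
    have le: "(1/2)^n * min (dist (g (from_nat n)) (h (from_nat n))) 1 \<le> (1/2)^n * \<delta>" for n
      using that[of "from_nat n"] by (intro mult_left_mono) (auto simp: dist_real_def min_def)
    have sum: "(\<lambda>n. (1/2)^n * \<delta>) sums (2 * \<delta>)"
      using sums_mult2[OF geometric_sums[of "1/2 :: real"], of \<delta>] by simp
    have "dist g h \<le> (\<Sum>n. (1/2)^n * \<delta>)"
      unfolding dist_fun_def
    proof (rule suminf_le[OF le])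
      show "summable (\<lambda>n. (1/2)^n * min (dist (g (from_nat n)) (h (from_nat n))) 1)"
        by (rule summable_comparison_test'[of "\<lambda>n. (1/2)^n"]) (auto simp: summable_geometric_iff)
    qed (rule sums_summable[OF sum])
    then show ?thesis using sums_unique[OF sum] by simp
  qed
  show ?thesis
  proof (rule that)
    show "d / 4 > 0" using d(1) by simp
    fix g h :: "nat \<Rightarrow> real"
    assume gh: "\<And>i. \<bar>g i\<bar> \<le> M i" "\<And>i. \<bar>h i\<bar> \<le> M i" "\<And>i. \<bar>g i - h i\<bar> \<le> d / 4"
    have "dist g h < d" using dist[of g h "d / 4", OF gh(3)] d(1) by simp
    moreover have "g \<in> {g. \<forall>i. \<bar>g i\<bar> \<le> M i}" "h \<in> {g. \<forall>i. \<bar>g i\<bar> \<le> M i}"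
      using gh(1,2) by simp_all
    ultimately have "dist (f g) (f h) < \<eta>" using d(2) by blast
    then show "\<bar>f g - f h\<bar> \<le> \<eta>" by (simp add: dist_real_def)
  qed
qed

abbreviation assignment :: "(nat \<Rightarrow> 'a::real_normed_vector) \<Rightarrow> bool" where
  "assignment v \<equiv> \<forall>k. v k \<in> cball 0 1"

lemma assignment_upd: "assignment v \<Longrightarrow> c \<in> cball 0 1 \<Longrightarrow> assignment (v(k := c))"
  by simp

text \<open>
  One parameter \<open>n\<close> controls both the number of coordinates and the tolerance. The base \<open>1/4\<close>
  is chosen because the back-and-forth step loses a factor of 4, which is then exactly one step in \<open>n\<close>.
\<close>

definition near :: "nat \<Rightarrow> (nat \<Rightarrow> 'x::topological_space \<Rightarrow>\<^sub>C complex) \<Rightarrow>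
    (nat \<Rightarrow> 'x \<Rightarrow>\<^sub>C complex) \<Rightarrow> 'x \<Rightarrow> (nat \<Rightarrow> 'x \<Rightarrow>\<^sub>C complex) \<Rightarrow> 'x \<Rightarrow> bool" where
  "near n \<alpha> v x w y \<longleftrightarrow> (\<forall>i\<in>initial n. dist (case_sum \<alpha> v i x) (case_sum \<alpha> w i y) \<le> (1/4)^n)"

text \<open>
  On a compact space this says that the joint ranges of \<open>(\<alpha>, v)\<close> and \<open>(\<alpha>, w)\<close> over the indices in
  \<open>initial n\<close> have Hausdorff distance at most \<open>(1/4)^n\<close> with respect to the maximum metric.
\<close>

definition close :: "nat \<Rightarrow> (nat \<Rightarrow> 'x::topological_space \<Rightarrow>\<^sub>C complex) \<Rightarrow>
    (nat \<Rightarrow> 'x \<Rightarrow>\<^sub>C complex) \<Rightarrow> (nat \<Rightarrow> 'x \<Rightarrow>\<^sub>C complex) \<Rightarrow> bool" where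
  "close n \<alpha> v w \<longleftrightarrow> (\<forall>x. \<exists>y. near n \<alpha> v x w y) \<and> (\<forall>y. \<exists>x. near n \<alpha> v x w y)"

lemma near_mono: "near m \<alpha> v x w y" if "near n \<alpha> v x w y" "m \<le> n"
  unfolding near_def
proof
  fix i assume "i \<in> initial m"
  then have "dist (case_sum \<alpha> v i x) (case_sum \<alpha> w i y) \<le> (1/4)^n"
    using that initial_mono[of m n] unfolding near_def by blast
  also have "\<dots> \<le> (1/4)^m" using that(2) by (intro power_decreasing) auto
  finally show "dist (case_sum \<alpha> v i x) (case_sum \<alpha> w i y) \<le> (1/4)^m" .
qed

lemma near_sym: "near n \<alpha> v x w y \<longleftrightarrow> near n \<alpha> w y v x"
  unfolding near_def by (simp add: dist_commute)

lemma close_mono: "close n \<alpha> v w \<Longrightarrow> m \<le> n \<Longrightarrow> close m \<alpha> v w"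
  unfolding close_def by (meson near_mono)

lemma close_sym: "close n \<alpha> v w \<longleftrightarrow> close n \<alpha> w v"
  unfolding close_def near_sym[of n \<alpha> v] by blast

lemma small_power:
  assumes "\<eta> > (0::real)"
  obtains n where "(1/4::real)^n \<le> \<eta>" "n > k"
proof -
  obtain m where m: "(1/4::real)^m < \<eta>" using real_arch_pow_inv[OF assms, of "1/4"] by auto
  have "(1/4::real)^(m + Suc k) \<le> (1/4)^m" by (intro power_decreasing) auto
  then show ?thesis using that[of "m + Suc k"] m by simp
qed

text \<open>
  The value of a polynomial at a point is a uniformly continuous function of the values of its variables and
  parameters at that point, as long as these stay bounded.
\<close>

lemma star_poly_bounded_local:
  fixes p :: "('x::topological_space \<Rightarrow>\<^sub>C complex) star_poly"
  assumes "set_star_poly p \<subseteq> range \<alpha>"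
  shows "(\<exists>B>0. \<forall>v. assignment v \<longrightarrow> norm (poly_val v p) \<le> B) \<and>
    (\<forall>\<eta>>0. \<exists>n. \<forall>v w x y. assignment v \<longrightarrow> assignment w \<longrightarrow> near n \<alpha> v x w y \<longrightarrow>
      dist (poly_val v p x) (poly_val w p y) \<le> \<eta>)"
    (is "?B p \<and> (\<forall>\<eta>>0. \<exists>n. ?L p \<eta> n)")
  using assms
proof (induction p)
  case (PVar k)
  have "?B (PVar k)" by (intro exI[of _ 1]) simp
  moreover have "\<exists>n. ?L (PVar k) \<eta> n" if "\<eta> > 0" for \<eta>
  proof -
    obtain n where n: "(1/4::real)^n \<le> \<eta>" "n > k" using small_power[OF \<open>\<eta> > 0\<close>] .
    have "Inr k \<in> initial n" using n(2) by (simp add: initial_def)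
    then have "?L (PVar k) \<eta> n" using n(1) unfolding near_def by force
    then show ?thesis ..
  qed
  ultimately show ?case by blast
next
  case (PParam a)
  then obtain i where i: "a = \<alpha> i" by auto
  have "?B (PParam a)" by (intro exI[of _ "norm a + 1"]) (simp add: add_nonneg_pos)
  moreover have "\<exists>n. ?L (PParam a) \<eta> n" if "\<eta> > 0" for \<eta>
  proof -
    obtain n where n: "(1/4::real)^n \<le> \<eta>" "n > i" using small_power[OF \<open>\<eta> > 0\<close>] .
    have "Inl i \<in> initial n" using n(2) by (simp add: initial_def)
    then have "?L (PParam a) \<eta> n" using n(1) unfolding near_def i by force
    then show ?thesis ..
  qed
  ultimately show ?case by blast
next
  case (PScalar c)
  have "?B (PScalar c)" by (intro exI[of _ "cmod c + 1"]) (simp add: norm_scaleC add_nonneg_pos)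
  moreover have "?L (PScalar c) \<eta> 0" if "\<eta> > 0" for \<eta>
    using that by (simp add: bcontfun_apply)
  ultimately show ?case by blast
next
  case (PAdd p q)
  have p: "?B p" "\<forall>\<eta>>0. \<exists>n. ?L p \<eta> n" and q: "?B q" "\<forall>\<eta>>0. \<exists>n. ?L q \<eta> n"
    using PAdd by simp_all
  obtain B where B: "B > 0" "\<And>v. assignment v \<Longrightarrow> norm (poly_val v p) \<le> B" using p(1) by blast
  obtain C where C: "C > 0" "\<And>v. assignment v \<Longrightarrow> norm (poly_val v q) \<le> C" using q(1) by blast
  have "norm (poly_val v (PAdd p q)) \<le> B + C" if "assignment v" for v
    using norm_triangle_ineq[of "poly_val v p" "poly_val v q"] B(2)[OF that] C(2)[OF that] by simp
  then have "?B (PAdd p q)" using B(1) C(1) by (intro exI[of _ "B + C"]) simp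
  moreover have "\<exists>n. ?L (PAdd p q) \<eta> n" if "\<eta> > 0" for \<eta>
  proof -
    have half: "\<eta> / 2 > 0" using that by simp
    obtain m where m: "?L p (\<eta> / 2) m" using p(2)[THEN spec, THEN mp, OF half] ..
    obtain n where n: "?L q (\<eta> / 2) n" using q(2)[THEN spec, THEN mp, OF half] ..
    have "dist (poly_val v (PAdd p q) x) (poly_val w (PAdd p q) y) \<le> \<eta>"
      if "assignment v" "assignment w" "near (max m n) \<alpha> v x w y" for v w x y
    proof -
      have "dist (poly_val v p x) (poly_val w p y) \<le> \<eta> / 2"
        using m that near_mono[OF that(3) max.cobounded1] by blast
      moreover have "dist (poly_val v q x) (poly_val w q y) \<le> \<eta> / 2"
        using n that near_mono[OF that(3) max.cobounded2] by blast
      ultimately show ?thesis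
        using norm_diff_triangle_ineq[of "poly_val v p x" "poly_val v q x" "poly_val w p y" "poly_val w q y"]
        by (simp add: bcontfun_apply dist_norm)
    qed
    then show ?thesis by blast
  qed
  ultimately show ?case by blast
next
  case (PMult p q)
  have p: "?B p" "\<forall>\<eta>>0. \<exists>n. ?L p \<eta> n" and q: "?B q" "\<forall>\<eta>>0. \<exists>n. ?L q \<eta> n"
    using PMult by simp_all
  obtain B where B: "B > 0" "\<And>v. assignment v \<Longrightarrow> norm (poly_val v p) \<le> B" using p(1) by blast
  obtain C where C: "C > 0" "\<And>v. assignment v \<Longrightarrow> norm (poly_val v q) \<le> C" using q(1) by blast
  have "norm (poly_val v (PMult p q)) \<le> B * C" if "assignment v" for v
    using norm_mult_ineq[of "poly_val v p" "poly_val v q"]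
      mult_mono[OF B(2)[OF that] C(2)[OF that]] B(1) by simp
  then have "?B (PMult p q)" using B(1) C(1) by (intro exI[of _ "B * C"]) simp
  moreover have "\<exists>n. ?L (PMult p q) \<eta> n" if "\<eta> > 0" for \<eta>
  proof -
    have pos: "\<eta> / (2 * C) > 0" "\<eta> / (2 * B) > 0" using that B(1) C(1) by simp_all
    obtain m where m: "?L p (\<eta> / (2 * C)) m" using p(2)[THEN spec, THEN mp, OF pos(1)] ..
    obtain n where n: "?L q (\<eta> / (2 * B)) n" using q(2)[THEN spec, THEN mp, OF pos(2)] ..
    have "dist (poly_val v (PMult p q) x) (poly_val w (PMult p q) y) \<le> \<eta>"
      if v: "assignment v" and w: "assignment w" and near: "near (max m n) \<alpha> v x w y" for v w x y
    proof -
      let ?p = "poly_val v p x" and ?q = "poly_val v q x" and ?p' = "poly_val w p y" and ?q' = "poly_val w q y"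
      have 1: "cmod (?p - ?p') \<le> \<eta> / (2 * C)"
        using m v w near_mono[OF near max.cobounded1] unfolding dist_norm by blast
      have 2: "cmod (?q - ?q') \<le> \<eta> / (2 * B)"
        using n v w near_mono[OF near max.cobounded2] unfolding dist_norm by blast
      have 3: "cmod ?p \<le> B" "cmod ?q' \<le> C"
        using norm_bounded[of "poly_val v p" x] B(2)[OF v] norm_bounded[of "poly_val w q" y] C(2)[OF w]
        by linarith+
      have "?p * ?q - ?p' * ?q' = ?p * (?q - ?q') + (?p - ?p') * ?q'" by (simp add: algebra_simps)
      then have "cmod (?p * ?q - ?p' * ?q') \<le> cmod ?p * cmod (?q - ?q') + cmod (?p - ?p') * cmod ?q'"
        by (metis norm_triangle_ineq norm_mult)
      also have "\<dots> \<le> B * (\<eta> / (2 * B)) + (\<eta> / (2 * C)) * C"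
        using 1 2 3 B(1) C(1) \<open>\<eta> > 0\<close> by (intro add_mono mult_mono) auto
      also have "\<dots> = \<eta>" using B(1) C(1) by simp
      finally show ?thesis by (simp add: bcontfun_apply dist_norm)
    qed
    then show ?thesis by blast
  qed
  ultimately show ?case by blast
next
  case (PStar p)
  have "dist (cnj a) (cnj b) = dist a b" for a b
    by (metis complex_cnj_diff complex_mod_cnj dist_norm)
  then have dist: "dist (poly_val v (PStar p) x) (poly_val w (PStar p) y) =
      dist (poly_val v p x) (poly_val w p y)" for v w x y
    by (simp add: bcontfun_apply)
  have norm: "norm (poly_val v (PStar p)) = norm (poly_val v p)" for v
    by (simp add: norm_star)
  show ?case unfolding dist norm using PStar.prems by (intro PStar.IH) simp
qed

context stone_space begin

text \<open>
  The back-and-forth step for functions on a space without isolated points. Both families are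
  approximated by locally constant maps \<open>p\<close> and \<open>q\<close>. Each fibre of \<open>q\<close> is
  divided among the finitely many fibres of \<open>p\<close> that come near it, and on each piece \<open>d\<close> copies the value
  of \<open>c\<close> at the centre of the assigned fibre of \<open>p\<close>. In particular \<open>d\<close> has no values other than those of \<open>c\<close>.
\<close>

lemma extend_close_functions:
  fixes a b :: "'i \<Rightarrow> 'x \<Rightarrow>\<^sub>C complex" and c :: "'x \<Rightarrow>\<^sub>C complex"
  assumes iso: "isolated_points = ({} :: 'x set)" and "finite S" "\<delta> > 0"
    and fwd: "\<And>x. \<exists>y. \<forall>i\<in>S. dist (a i x) (b i y) \<le> \<delta>"
    and bwd: "\<And>y. \<exists>x. \<forall>i\<in>S. dist (a i x) (b i y) \<le> \<delta>"
  obtains d :: "'x \<Rightarrow>\<^sub>C complex" where "range d \<subseteq> range c"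
    "\<And>x. \<exists>y. (\<forall>i\<in>S. dist (a i x) (b i y) \<le> 4 * \<delta>) \<and> dist (c x) (d y) \<le> 4 * \<delta>"
    "\<And>y. \<exists>x. (\<forall>i\<in>S. dist (a i x) (b i y) \<le> 4 * \<delta>) \<and> dist (c x) (d y) \<le> 4 * \<delta>"
proof -
  define h where "h j = (case j of None \<Rightarrow> apply_bcontfun c | Some i \<Rightarrow> apply_bcontfun (a i))" for j
  have cont: "continuous_on UNIV (apply_bcontfun f)" for f :: "'x \<Rightarrow>\<^sub>C complex"
    by (auto intro!: continuous_intros)
  then have "continuous_on UNIV (h j)" for j by (cases j) (simp_all add: h_def)
  then obtain p :: "'x \<Rightarrow> 'x" where p: "locally_constant p" "finite (range p)"
    "\<And>j x. j \<in> insert None (Some ` S) \<Longrightarrow> dist (h j x) (h j (p x)) < \<delta>"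
    using locally_constant_refinement[of "insert None (Some ` S)" h \<delta>] \<open>finite S\<close> \<open>\<delta> > 0\<close> by auto
  have pa: "dist (a i x) (a i (p x)) \<le> \<delta>" if "i \<in> S" for i x
    using p(3)[of "Some i" x] that by (simp add: h_def)
  have pc: "dist (c x) (c (p x)) \<le> \<delta>" for x
    using p(3)[of None x] by (simp add: h_def)
  obtain q :: "'x \<Rightarrow> 'x" where q: "locally_constant q" "finite (range q)"
    "\<forall>i\<in>S. \<forall>x. dist (b i x) (b i (q x)) < \<delta>"
    by (rule locally_constant_refinement[of S "\<lambda>i. apply_bcontfun (b i)" \<delta>, OF \<open>finite S\<close> cont \<open>\<delta> > 0\<close>])
      blast
  define J where "J l = p ` {x. \<exists>y. q y = l \<and> (\<forall>i\<in>S. dist (a i x) (b i y) \<le> \<delta>)}" for l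
  have fin: "finite (J l)" for l using p(2) by (rule finite_subset[rotated]) (auto simp: J_def)
  have ne: "J (q y) \<noteq> {}" for y using bwd[of y] by (auto simp: J_def)
  obtain r where r: "locally_constant r" "\<And>y. r ` (q -` {q y}) = J (q y)"
    using prescribed_fibre_images[of q J, OF q(1) fin ne] iso by blast
  have "continuous_on UNIV (\<lambda>y. c (r y))"
    by (rule continuous_locally_constant[OF locally_constant_compose[OF r(1)]])
  then obtain d where d: "apply_bcontfun d = (\<lambda>y. c (r y))" using bcontfun_of_continuous by blast
  have near: "dist (a i x) (b i y') \<le> 3 * \<delta>"
    if "i \<in> S" "q y' = q y" "\<forall>i\<in>S. dist (a i x) (b i y) \<le> \<delta>" for i x y y'
  proof -
    have "dist (a i x) (b i y') \<le> dist (a i x) (b i y) + dist (b i y) (b i (q y)) + dist (b i y') (b i (q y'))"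
      using that(2) dist_triangle[of "a i x" "b i y'" "b i y"]
        dist_triangle2[of "b i y" "b i y'" "b i (q y)"] by simp
    also have "\<dots> \<le> \<delta> + \<delta> + \<delta>"
      using that(1,3) q(3) by (intro add_mono) (auto intro: less_imp_le)
    finally show ?thesis by simp
  qed
  show ?thesis
  proof (rule that[of d])
    show "range d \<subseteq> range c" unfolding d by auto
    fix x
    obtain y where y: "\<forall>i\<in>S. dist (a i x) (b i y) \<le> \<delta>" using fwd[of x] by blast
    then have "p x \<in> J (q y)" by (auto simp: J_def)
    then obtain y' where y': "q y' = q y" "r y' = p x" using r(2)[of y] by (metis imageE vimage_singleton_eq)
    have "dist (c x) (d y') \<le> 4 * \<delta>" using pc[of x] y'(2) \<open>\<delta> > 0\<close> by (simp add: d)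
    moreover have "dist (a i x) (b i y') \<le> 4 * \<delta>" if "i \<in> S" for i
      using near[OF that y'(1) y] \<open>\<delta> > 0\<close> by simp
    ultimately show "\<exists>y. (\<forall>i\<in>S. dist (a i x) (b i y) \<le> 4 * \<delta>) \<and> dist (c x) (d y) \<le> 4 * \<delta>" by blast
  next
    fix y
    have "r y \<in> J (q y)" using r(2)[of y] by blast
    then obtain x y' where x: "r y = p x" "q y' = q y" "\<forall>i\<in>S. dist (a i x) (b i y') \<le> \<delta>"
      by (auto simp: J_def)
    have "dist (c (r y)) (d y) \<le> 4 * \<delta>" using \<open>\<delta> > 0\<close> by (simp add: d)
    moreover have "dist (a i (r y)) (b i y) \<le> 4 * \<delta>" if "i \<in> S" for i
      using near[OF that x(2)[symmetric] x(3)] pa[OF that, of x] dist_triangle3[of "a i (p x)" "b i y" "a i x"]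
      by (simp add: x(1))
    ultimately show "\<exists>x. (\<forall>i\<in>S. dist (a i x) (b i y) \<le> 4 * \<delta>) \<and> dist (c x) (d y) \<le> 4 * \<delta>" by blast
  qed
qed

lemma close_extend:
  fixes \<alpha> :: "nat \<Rightarrow> 'x \<Rightarrow>\<^sub>C complex"
  assumes iso: "isolated_points = ({} :: 'x set)" and "close (Suc n) \<alpha> v w" and c: "c \<in> cball 0 1"
  obtains d where "d \<in> cball 0 1" "close n \<alpha> (v(k := c)) (w(k := d))"
proof -
  have \<delta>: "(1/4::real)^Suc n > 0" "4 * (1/4::real)^Suc n = (1/4)^n" by simp_all
  obtain d :: "'x \<Rightarrow>\<^sub>C complex" where d: "range d \<subseteq> range c"
    "\<And>x. \<exists>y. (\<forall>i\<in>initial (Suc n). dist (case_sum \<alpha> v i x) (case_sum \<alpha> w i y) \<le> 4 * (1/4)^Suc n) \<and>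
      dist (c x) (d y) \<le> 4 * (1/4)^Suc n"
    "\<And>y. \<exists>x. (\<forall>i\<in>initial (Suc n). dist (case_sum \<alpha> v i x) (case_sum \<alpha> w i y) \<le> 4 * (1/4)^Suc n) \<and>
      dist (c x) (d y) \<le> 4 * (1/4)^Suc n"
    using extend_close_functions[of "initial (Suc n)" "(1/4)^Suc n" "case_sum \<alpha> v" "case_sum \<alpha> w" c,
        OF iso finite_initial \<delta>(1)] assms(2) unfolding close_def near_def by blast
  have near: "near n \<alpha> (v(k := c)) x (w(k := d)) y"
    if "\<forall>i\<in>initial (Suc n). dist (case_sum \<alpha> v i x) (case_sum \<alpha> w i y) \<le> 4 * (1/4)^Suc n"
      "dist (c x) (d y) \<le> 4 * (1/4)^Suc n" for x y
    unfolding near_def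
  proof
    fix i assume "i \<in> initial n"
    then have i: "i \<in> initial (Suc n)" using initial_mono[of n "Suc n"] by auto
    show "dist (case_sum \<alpha> (v(k := c)) i x) (case_sum \<alpha> (w(k := d)) i y) \<le> (1/4)^n"
    proof (cases "i = Inr k")
      case True
      then show ?thesis using that(2) unfolding \<delta>(2) by simp
    next
      case False
      then have "case_sum \<alpha> (v(k := c)) i = case_sum \<alpha> v i" "case_sum \<alpha> (w(k := d)) i = case_sum \<alpha> w i"
        by (auto split: sum.split)
      then show ?thesis using that(1) i unfolding \<delta>(2) by simp
    qed
  qed
  have "close n \<alpha> (v(k := c)) (w(k := d))" unfolding close_def using near d(2,3) by meson
  moreover have "norm d \<le> 1"
  proof (rule norm_bound)
    fix y
    obtain x where "d y = c x" using d(1) by blast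
    then show "cmod (d y) \<le> 1" using c norm_bounded[of c x] by simp
  qed
  ultimately show ?thesis using that[of d] by simp
qed

text \<open>
  By the back-and-forth step every value of \<open>F\<close> over \<open>v\<close> is approximated by one over \<open>w\<close>; this
  gives one of the two inequalities between the suprema and between the infima, and exchanging \<open>v\<close> and \<open>w\<close>
  gives the other.
\<close>

lemma quantifier_modulus:
  fixes F :: "(nat \<Rightarrow> 'x \<Rightarrow>\<^sub>C complex) \<Rightarrow> real"
  assumes iso: "isolated_points = ({} :: 'x set)"
    and bound: "\<forall>v. assignment v \<longrightarrow> \<bar>F v\<bar> \<le> B"
    and local: "\<forall>v w. assignment v \<longrightarrow> assignment w \<longrightarrow> close n \<alpha> v w \<longrightarrow> \<bar>F v - F w\<bar> \<le> \<eta>"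
    and vw: "assignment v" "assignment w" "close (Suc n) \<alpha> v w"
  shows "(SUP a\<in>cball 0 1. F (v(k := a))) \<le> (SUP a\<in>cball 0 1. F (w(k := a))) + \<eta>"
    and "(INF a\<in>cball 0 1. F (w(k := a))) - \<eta> \<le> (INF a\<in>cball 0 1. F (v(k := a)))"
proof -
  have bdd: "bdd_above ((\<lambda>a. F (u(k := a))) ` cball 0 1)" "bdd_below ((\<lambda>a. F (u(k := a))) ` cball 0 1)"
    if "assignment u" for u
  proof -
    have "- B \<le> F (u(k := a)) \<and> F (u(k := a)) \<le> B" if "a \<in> cball 0 1" for a
      using bound[THEN spec, THEN mp, OF assignment_upd[OF \<open>assignment u\<close> that, of k]]
      unfolding abs_le_iff by linarith
    then show "bdd_above ((\<lambda>a. F (u(k := a))) ` cball 0 1)" "bdd_below ((\<lambda>a. F (u(k := a))) ` cball 0 1)"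
      by (auto intro!: bdd_aboveI2[of _ _ B] bdd_belowI2[of _ "- B"])
  qed
  have ext: "\<exists>d\<in>cball 0 1. \<bar>F (v(k := c)) - F (w(k := d))\<bar> \<le> \<eta>" if "c \<in> cball 0 1" for c
  proof -
    obtain d where d: "d \<in> cball 0 1" "close n \<alpha> (v(k := c)) (w(k := d))"
      using close_extend[OF iso vw(3) \<open>c \<in> cball 0 1\<close>] by blast
    have "\<bar>F (v(k := c)) - F (w(k := d))\<bar> \<le> \<eta>"
      using local assignment_upd[OF vw(1) \<open>c \<in> cball 0 1\<close>, of k] assignment_upd[OF vw(2) d(1), of k] d(2) by blast
    then show ?thesis using d(1) by blast
  qed
  have ne: "cball (0 :: 'x \<Rightarrow>\<^sub>C complex) 1 \<noteq> {}" by simp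
  show "(SUP a\<in>cball 0 1. F (v(k := a))) \<le> (SUP a\<in>cball 0 1. F (w(k := a))) + \<eta>"
  proof (rule cSUP_least[OF ne])
    fix c :: "'x \<Rightarrow>\<^sub>C complex" assume "c \<in> cball 0 1"
    then obtain d where d: "d \<in> cball 0 1" "\<bar>F (v(k := c)) - F (w(k := d))\<bar> \<le> \<eta>" using ext by blast
    have "F (w(k := d)) \<le> (SUP a\<in>cball 0 1. F (w(k := a)))"
      by (rule cSUP_upper[OF d(1) bdd(1)[OF vw(2)]])
    then show "F (v(k := c)) \<le> (SUP a\<in>cball 0 1. F (w(k := a))) + \<eta>" using d(2) by linarith
  qed
  show "(INF a\<in>cball 0 1. F (w(k := a))) - \<eta> \<le> (INF a\<in>cball 0 1. F (v(k := a)))"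
  proof (rule cINF_greatest[OF ne])
    fix c :: "'x \<Rightarrow>\<^sub>C complex" assume "c \<in> cball 0 1"
    then obtain d where d: "d \<in> cball 0 1" "\<bar>F (v(k := c)) - F (w(k := d))\<bar> \<le> \<eta>" using ext by blast
    have "(INF a\<in>cball 0 1. F (w(k := a))) \<le> F (w(k := d))"
      by (rule cINF_lower[OF bdd(2)[OF vw(2)] d(1)])
    then show "(INF a\<in>cball 0 1. F (w(k := a))) - \<eta> \<le> F (v(k := c))" using d(2) by linarith
  qed
qed

lemma quantifier_bounded:
  fixes F :: "(nat \<Rightarrow> 'x \<Rightarrow>\<^sub>C complex) \<Rightarrow> real"
  assumes bound: "\<forall>v. assignment v \<longrightarrow> \<bar>F v\<bar> \<le> B" and v: "assignment v"
  shows "\<bar>SUP a\<in>cball 0 1. F (v(k := a))\<bar> \<le> B" "\<bar>INF a\<in>cball 0 1. F (v(k := a))\<bar> \<le> B"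
proof -
  have ne: "(\<lambda>a. F (v(k := a))) ` cball 0 1 \<noteq> {}" by simp
  have le: "\<bar>y\<bar> \<le> B" if y: "y \<in> (\<lambda>a. F (v(k := a))) ` cball 0 1" for y
  proof -
    obtain a where "a \<in> cball 0 1" "y = F (v(k := a))" using y by blast
    then show ?thesis using bound assignment_upd[OF v, of a k] by blast
  qed
  show "\<bar>SUP a\<in>cball 0 1. F (v(k := a))\<bar> \<le> B" by (rule cSup_abs_le[OF ne le])
  show "\<bar>INF a\<in>cball 0 1. F (v(k := a))\<bar> \<le> B" by (rule cInf_abs_ge[OF ne le])
qed

text \<open>
  Boundedness, and uniform continuity with respect to the joint range of parameters and
  variables. Boundedness is part of the induction because suprema, infima and the
  uniform continuity of connectives depend on it.
\<close>

definition has_modulus ::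
    "(nat \<Rightarrow> 'x \<Rightarrow>\<^sub>C complex) \<Rightarrow> ((nat \<Rightarrow> 'x \<Rightarrow>\<^sub>C complex) \<Rightarrow> real) \<Rightarrow> bool" where
  "has_modulus \<alpha> F \<longleftrightarrow> (\<exists>B. \<forall>v. assignment v \<longrightarrow> \<bar>F v\<bar> \<le> B) \<and>
    (\<forall>\<eta>>0. \<exists>n. \<forall>v w. assignment v \<longrightarrow> assignment w \<longrightarrow> close n \<alpha> v w \<longrightarrow> \<bar>F v - F w\<bar> \<le> \<eta>)"

lemma has_modulusI:
  assumes "\<And>v. assignment v \<Longrightarrow> \<bar>F v\<bar> \<le> B"
    "\<And>\<eta>. \<eta> > 0 \<Longrightarrow> \<exists>n. \<forall>v w. assignment v \<longrightarrow> assignment w \<longrightarrow> close n \<alpha> v w \<longrightarrow> \<bar>F v - F w\<bar> \<le> \<eta>"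
  shows "has_modulus \<alpha> F"
  using assms unfolding has_modulus_def by blast

lemma has_modulus_norm:
  assumes "set_star_poly p \<subseteq> range \<alpha>"
  shows "has_modulus \<alpha> (\<lambda>v. norm (poly_val v p))"
proof -
  note p = star_poly_bounded_local[OF assms]
  obtain B where B: "\<And>v. assignment v \<Longrightarrow> norm (poly_val v p) \<le> B" using p by blast
  show ?thesis
  proof (rule has_modulusI)
    show "\<bar>norm (poly_val v p)\<bar> \<le> B" if "assignment v" for v using B[OF that] by simp
    fix \<eta> :: real assume "\<eta> > 0"
    then obtain n where n: "\<And>v w x y. assignment v \<Longrightarrow> assignment w \<Longrightarrow> near n \<alpha> v x w y \<Longrightarrow>
      dist (poly_val v p x) (poly_val w p y) \<le> \<eta>" using p by blast
    have half: "norm (poly_val v p) \<le> norm (poly_val w p) + \<eta>"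
      if v: "assignment v" and w: "assignment w" and "close n \<alpha> v w" for v w
    proof -
      obtain x where x: "norm (poly_val v p) = cmod (poly_val v p x)" by (rule norm_attained)
      obtain y where "near n \<alpha> v x w y" using \<open>close n \<alpha> v w\<close> unfolding close_def by blast
      from n[OF v w this] have "cmod (poly_val v p x) \<le> cmod (poly_val w p y) + \<eta>"
        using norm_triangle_ineq2[of "poly_val v p x" "poly_val w p y"] by (simp add: dist_norm)
      also have "cmod (poly_val w p y) \<le> norm (poly_val w p)" by (rule norm_bounded)
      finally show ?thesis using x by simp
    qed
    have "\<bar>norm (poly_val v p) - norm (poly_val w p)\<bar> \<le> \<eta>"
      if "assignment v" "assignment w" "close n \<alpha> v w" for v w
      using half[OF that] half[OF that(2,1) that(3)[unfolded close_sym[of n \<alpha> v]]] by linarith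
    then show "\<exists>n. \<forall>v w. assignment v \<longrightarrow> assignment w \<longrightarrow> close n \<alpha> v w \<longrightarrow>
        \<bar>norm (poly_val v p) - norm (poly_val w p)\<bar> \<le> \<eta>" by blast
  qed
qed

lemma has_modulus_connective:
  fixes l :: nat
  assumes "continuous_on UNIV f" and F: "\<And>i. i < l \<Longrightarrow> has_modulus \<alpha> (F i)"
  shows "has_modulus \<alpha> (\<lambda>v. f (\<lambda>i. if i < l then F i v else 0))"
proof -
  have "\<exists>B. \<forall>v. assignment v \<longrightarrow> \<bar>F i v\<bar> \<le> B" if "i < l" for i
    using F[OF that] unfolding has_modulus_def by blast
  then obtain M' where M': "\<And>i v. i < l \<Longrightarrow> assignment v \<Longrightarrow> \<bar>F i v\<bar> \<le> M' i" by metis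
  define M where "M i = (if i < l then M' i else 0)" for i
  let ?g = "\<lambda>v i. if i < l then F i v else 0"
  have M: "\<bar>?g v i\<bar> \<le> M i" if "assignment v" for v i
    using M'[OF _ that] by (simp add: M_def)
  obtain B where B: "\<And>g. (\<And>i. \<bar>g i\<bar> \<le> M i) \<Longrightarrow> \<bar>f g\<bar> \<le> B"
    using connective_bounded[OF assms(1), of M] by blast
  show ?thesis
  proof (rule has_modulusI)
    show "\<bar>f (?g v)\<bar> \<le> B" if "assignment v" for v
      by (rule B, rule M[OF that])
    fix \<eta> :: real assume "\<eta> > 0"
    then obtain \<delta> where \<delta>: "\<delta> > 0" "\<And>g h. (\<And>i. \<bar>g i\<bar> \<le> M i) \<Longrightarrow> (\<And>i. \<bar>h i\<bar> \<le> M i) \<Longrightarrow>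
        (\<And>i. \<bar>g i - h i\<bar> \<le> \<delta>) \<Longrightarrow> \<bar>f g - f h\<bar> \<le> \<eta>"
      using connective_uniformly_continuous[OF assms(1), of \<eta> M] by blast
    let ?P = "\<lambda>i n. \<forall>v w. assignment v \<longrightarrow> assignment w \<longrightarrow> close n \<alpha> v w \<longrightarrow> \<bar>F i v - F i w\<bar> \<le> \<delta>"
    have "\<exists>n. \<forall>i<l. ?P i n"
    proof (rule common_bound)
      show "\<exists>n. ?P i n" if "i < l" for i using F[OF that] \<delta>(1) unfolding has_modulus_def by blast
      show "?P i n" if "?P i m" "m \<le> n" for i m n using that(1) close_mono[OF _ that(2)] by blast
    qed
    then obtain n where n: "\<forall>i<l. ?P i n" ..
    have "\<bar>f (?g v) - f (?g w)\<bar> \<le> \<eta>" if vw: "assignment v" "assignment w" "close n \<alpha> v w" for v w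
    proof (rule \<delta>(2)[OF M[OF vw(1)] M[OF vw(2)]])
      show "\<bar>?g v i - ?g w i\<bar> \<le> \<delta>" for i using n vw \<delta>(1) by simp
    qed
    then show "\<exists>n. \<forall>v w. assignment v \<longrightarrow> assignment w \<longrightarrow> close n \<alpha> v w \<longrightarrow> \<bar>f (?g v) - f (?g w)\<bar> \<le> \<eta>"
      by blast
  qed
qed

lemma has_modulus_quantifier:
  assumes iso: "isolated_points = ({} :: 'x set)" and F: "has_modulus \<alpha> F"
  shows "has_modulus \<alpha> (\<lambda>v. SUP a\<in>cball 0 1. F (v(k := a)))"
    and "has_modulus \<alpha> (\<lambda>v. INF a\<in>cball 0 1. F (v(k := a)))"
proof -
  obtain B where B: "\<forall>v. assignment v \<longrightarrow> \<bar>F v\<bar> \<le> B" using F unfolding has_modulus_def by blast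
  have *: "\<exists>n. \<forall>v w. assignment v \<longrightarrow> assignment w \<longrightarrow> close n \<alpha> v w \<longrightarrow>
      \<bar>(SUP a\<in>cball 0 1. F (v(k := a))) - (SUP a\<in>cball 0 1. F (w(k := a)))\<bar> \<le> \<eta> \<and>
      \<bar>(INF a\<in>cball 0 1. F (v(k := a))) - (INF a\<in>cball 0 1. F (w(k := a)))\<bar> \<le> \<eta>" if "\<eta> > 0" for \<eta>
  proof -
    obtain n where n: "\<forall>v w. assignment v \<longrightarrow> assignment w \<longrightarrow> close n \<alpha> v w \<longrightarrow> \<bar>F v - F w\<bar> \<le> \<eta>"
      using F \<open>\<eta> > 0\<close> unfolding has_modulus_def by blast
    show ?thesis
    proof (rule exI[of _ "Suc n"], intro allI impI)
      fix v w assume v: "assignment v" and w: "assignment w" and vw: "close (Suc n) \<alpha> v w"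
      note 1 = quantifier_modulus[where F = F, OF iso B n v w vw, of k]
      note 2 = quantifier_modulus[where F = F, OF iso B n w v vw[unfolded close_sym[of "Suc n" \<alpha> v]], of k]
      show "\<bar>(SUP a\<in>cball 0 1. F (v(k := a))) - (SUP a\<in>cball 0 1. F (w(k := a)))\<bar> \<le> \<eta> \<and>
        \<bar>(INF a\<in>cball 0 1. F (v(k := a))) - (INF a\<in>cball 0 1. F (w(k := a)))\<bar> \<le> \<eta>"
        using 1 2 by linarith
    qed
  qed
  show "has_modulus \<alpha> (\<lambda>v. SUP a\<in>cball 0 1. F (v(k := a)))"
    by (rule has_modulusI, rule quantifier_bounded(1)[OF B]) (use * in blast)+
  show "has_modulus \<alpha> (\<lambda>v. INF a\<in>cball 0 1. F (v(k := a)))"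
    by (rule has_modulusI, rule quantifier_bounded(2)[OF B]) (use * in blast)+
qed

lemma has_modulus_formula:
  fixes \<phi> :: "('x \<Rightarrow>\<^sub>C complex) formula"
  assumes iso: "isolated_points = ({} :: 'x set)" and "\<phi> \<in> formulas" "set_formula \<phi> \<subseteq> range \<alpha>"
  shows "has_modulus \<alpha> (formula_val \<phi>)"
  using assms(2,3)
proof induction
  case (1 p)
  then show ?case using has_modulus_norm[of p \<alpha>] by simp
next
  case (2 f \<phi>s)
  have "has_modulus \<alpha> (\<lambda>v. f (\<lambda>i. if i < length \<phi>s then (map formula_val \<phi>s ! i) v else 0))"
  proof (rule has_modulus_connective[OF 2(1)])
    fix i assume i: "i < length \<phi>s"
    then have "\<phi>s ! i \<in> set \<phi>s" by simp
    moreover from this have "set_formula (\<phi>s ! i) \<subseteq> range \<alpha>" using 2(4) by auto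
    ultimately have "has_modulus \<alpha> (formula_val (\<phi>s ! i))" using 2(3) by blast
    then show "has_modulus \<alpha> (map formula_val \<phi>s ! i)" using i by simp
  qed
  then show ?case by simp
next
  case (3 \<phi> k)
  then show ?case using has_modulus_quantifier(1)[OF iso, of \<alpha> "formula_val \<phi>" k] by simp
next
  case (4 \<phi> k)
  then show ?case using has_modulus_quantifier(2)[OF iso, of \<alpha> "formula_val \<phi>" k] by simp
qed

end

section \<open>Coding functions by clopen sets\<close>

text \<open>
  Numbers in \<open>[- 1, 1]\<close> are expanded in base \<open>3/2\<close> with digits \<open>1\<close> and \<open>- 1\<close>. As the base is less
  than 2, the numbers with an expansion starting with \<open>1\<close> and those with one starting with \<open>- 1\<close>
  overlap, in the interval \<open>[- 1/3, 1/3]\<close>. This is what allows the digits of a continuous function to be locally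
  constant functions.
\<close>

definition digit_sum :: "(nat \<Rightarrow> bool) \<Rightarrow> real" where
  "digit_sum s = (\<Sum>j. (1/3) * (2/3)^j * (if s j then 1 else - 1))"

lemma digit_sum_uniformly_continuous:
  assumes "\<And>j. j < n \<Longrightarrow> s j = t j"
  shows "\<bar>digit_sum s - digit_sum t\<bar> \<le> 2 * (2/3)^n"
proof -
  define f :: "(nat \<Rightarrow> bool) \<Rightarrow> nat \<Rightarrow> real" where "f s j = (1/3) * (2/3)^j * (if s j then 1 else - 1)" for s j
  have geo: "(\<lambda>j. (1/3) * (2/3)^(j + k)) sums (2/3 :: real)^k" for k
  proof -
    have "(\<lambda>j. (2/3 :: real)^j) sums (1 / (1 - 2/3))" by (intro geometric_sums) simp
    from sums_mult[OF this, of "(1/3) * (2/3)^k"] show ?thesis by (simp add: power_add mult_ac)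
  qed
  have le: "norm (f s j) \<le> (1/3) * (2/3)^j" for s j by (simp add: f_def abs_mult)
  have summable: "summable (f s)" for s
    using summable_comparison_test'[OF sums_summable[OF geo[of 0]], of 0 "f s"] le by simp
  have tail: "\<bar>\<Sum>j. f s (j + n)\<bar> \<le> (2/3)^n" for s
    using norm_suminf_le[of "\<lambda>j. f s (j + n)" "\<lambda>j. (1/3) * (2/3)^(j + n)", OF le sums_summable[OF geo]]
      sums_unique[OF geo[of n]] by simp
  have split: "digit_sum s = (\<Sum>j. f s (j + n)) + (\<Sum>j<n. f s j)" for s
    using suminf_split_initial_segment[OF summable, of s n] unfolding digit_sum_def f_def .
  have "(\<Sum>j<n. f s j) = (\<Sum>j<n. f t j)" using assms by (intro sum.cong) (auto simp: f_def)
  then show ?thesis unfolding split using tail[of s] tail[of t] by linarith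
qed

text \<open>
  Even positions hold the digits of the real part and odd positions those of the imaginary part.
\<close>

definition decode :: "(nat \<Rightarrow> bool) \<Rightarrow> complex" where
  "decode s = Complex (digit_sum (\<lambda>j. s (2 * j))) (digit_sum (\<lambda>j. s (2 * j + 1)))"

lemma decode_uniformly_continuous:
  assumes "\<epsilon> > 0"
  obtains n where "\<And>s t. (\<And>j. j < n \<Longrightarrow> s j = t j) \<Longrightarrow> dist (decode s) (decode t) < \<epsilon>"
proof -
  obtain n where n: "(2/3 :: real)^n < \<epsilon> / 4" using real_arch_pow_inv[of "\<epsilon> / 4" "2/3"] assms by auto
  have "dist (decode s) (decode t) < \<epsilon>" if st: "\<And>j. j < 2 * n \<Longrightarrow> s j = t j" for s t
  proof -
    have "\<bar>digit_sum (\<lambda>j. s (2 * j)) - digit_sum (\<lambda>j. t (2 * j))\<bar> \<le> 2 * (2/3)^n"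
      by (rule digit_sum_uniformly_continuous) (simp add: st)
    moreover have "\<bar>digit_sum (\<lambda>j. s (2 * j + 1)) - digit_sum (\<lambda>j. t (2 * j + 1))\<bar> \<le> 2 * (2/3)^n"
      by (rule digit_sum_uniformly_continuous) (simp add: st)
    moreover have "dist (decode s) (decode t) \<le>
        \<bar>digit_sum (\<lambda>j. s (2 * j)) - digit_sum (\<lambda>j. t (2 * j))\<bar> +
        \<bar>digit_sum (\<lambda>j. s (2 * j + 1)) - digit_sum (\<lambda>j. t (2 * j + 1))\<bar>"
      using cmod_le[of "decode s - decode t"] by (simp add: dist_norm decode_def)
    ultimately show ?thesis using n by linarith
  qed
  then show ?thesis using that by blast
qed

lemma continuous_decode:
  fixes W :: "nat \<Rightarrow> 'x::topological_space set"
  assumes "\<And>j. clopen (W j)"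
  shows "continuous_on UNIV (\<lambda>x. decode (\<lambda>j. x \<in> W j))"
  unfolding continuous_on_def
proof (intro ballI tendstoI)
  fix x :: 'x and \<epsilon> :: real assume "\<epsilon> > 0"
  then obtain n where n: "\<And>s t. (\<And>j. j < n \<Longrightarrow> s j = t j) \<Longrightarrow> dist (decode s) (decode t) < \<epsilon>"
    using decode_uniformly_continuous by blast
  let ?U = "pattern {..<n} W -` {pattern {..<n} W x}"
  have "locally_constant (pattern {..<n} W)" by (rule locally_constant_pattern) (simp_all add: assms)
  then have "open ?U" by (simp add: locally_constant_def)
  moreover have "dist (decode (\<lambda>j. y \<in> W j)) (decode (\<lambda>j. x \<in> W j)) < \<epsilon>" if "y \<in> ?U" for y
    using that by (intro n) (auto simp: pattern_def)
  ultimately show "\<forall>\<^sub>F y in at x within UNIV. dist (decode (\<lambda>j. y \<in> W j)) (decode (\<lambda>j. x \<in> W j)) < \<epsilon>"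
    unfolding eventually_at_topological by (intro exI[of _ ?U]) simp
qed

context stone_space begin

text \<open>
  If \<open>g\<close> has values in \<open>[- 1, 1]\<close>, then so has the remainder \<open>(3 g - d) / 2\<close>, provided that the digit
  \<open>d\<close> is \<open>1\<close> where \<open>g > 1/3\<close> and \<open>- 1\<close> where \<open>g < - 1/3\<close>. The sign of a locally constant
  approximation of \<open>g\<close> up to \<open>1/3\<close> is such a digit. Iterating produces all digits.
\<close>

lemma digit_expansion:
  fixes f :: "'x \<Rightarrow> real"
  assumes "continuous_on UNIV f" "\<And>x. \<bar>f x\<bar> \<le> 1"
  obtains W :: "nat \<Rightarrow> 'x set" where "\<And>j. clopen (W j)" "\<And>x. f x = digit_sum (\<lambda>j. x \<in> W j)"
proof -
  define d :: "'x set \<Rightarrow> 'x \<Rightarrow> real" where "d U x = (if x \<in> U then 1 else - 1)" for U x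
  have step: "\<exists>U. clopen U \<and> continuous_on UNIV (\<lambda>x. (3 * g x - d U x) / 2) \<and> (\<forall>x. \<bar>(3 * g x - d U x) / 2\<bar> \<le> 1)"
    if g: "continuous_on UNIV g" "\<forall>x. \<bar>g x\<bar> \<le> 1" for g :: "'x \<Rightarrow> real"
  proof -
    obtain p :: "'x \<Rightarrow> 'x" where p: "locally_constant p" "\<And>x. dist (g x) (g (p x)) < 1/3"
      using locally_constant_refinement[of "{()}" "\<lambda>_. g" "1/3"] g(1) by auto
    define U where "U = p -` {x. 0 \<le> g x}"
    have U: "clopen U" unfolding U_def by (rule clopen_vimage_locally_constant[OF p(1)])
    have "d U = (\<lambda>x. if x \<in> U then 1 else - 1)" by (simp add: d_def fun_eq_iff)
    then have "continuous_on UNIV (d U)"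
      using locally_constant_if[OF U locally_constant_const locally_constant_const]
      by (intro continuous_locally_constant) simp
    then have "continuous_on UNIV (\<lambda>x. (3 * g x - d U x) / 2)"
      using g(1) by (intro continuous_intros) auto
    moreover have "\<bar>(3 * g x - d U x) / 2\<bar> \<le> 1" for x
      using p(2)[of x] g(2)[rule_format, of x] by (auto simp: d_def U_def dist_real_def abs_if split: if_splits)
    ultimately show ?thesis using U by blast
  qed
  have "\<exists>g. \<forall>j. (continuous_on UNIV (g j) \<and> (\<forall>x. \<bar>g j x\<bar> \<le> 1) \<and> (j = 0 \<longrightarrow> g j = f)) \<and>
      (\<exists>U. clopen U \<and> g (Suc j) = (\<lambda>x. (3 * g j x - d U x) / 2))"
  proof (rule dependent_nat_choice)
    show "\<exists>g. continuous_on UNIV g \<and> (\<forall>x. \<bar>g x\<bar> \<le> 1) \<and> (0 = (0::nat) \<longrightarrow> g = f)"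
      using assms by (intro exI[of _ f]) simp
    fix g :: "'x \<Rightarrow> real" and j :: nat
    assume "continuous_on UNIV g \<and> (\<forall>x. \<bar>g x\<bar> \<le> 1) \<and> (j = 0 \<longrightarrow> g = f)"
    then obtain U where "clopen U" "continuous_on UNIV (\<lambda>x. (3 * g x - d U x) / 2)"
      "\<forall>x. \<bar>(3 * g x - d U x) / 2\<bar> \<le> 1" using step by blast
    then show "\<exists>h. (continuous_on UNIV h \<and> (\<forall>x. \<bar>h x\<bar> \<le> 1) \<and> (Suc j = 0 \<longrightarrow> h = f)) \<and>
        (\<exists>U. clopen U \<and> h = (\<lambda>x. (3 * g x - d U x) / 2))"
      by (intro exI[of _ "\<lambda>x. (3 * g x - d U x) / 2"]) auto
  qed
  then obtain g where g: "\<And>j x. \<bar>g j x\<bar> \<le> 1" "g 0 = f"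
    "\<forall>j. \<exists>U. clopen U \<and> g (Suc j) = (\<lambda>x. (3 * g j x - d U x) / 2)" by blast
  obtain W where W: "\<And>j. clopen (W j)" "\<And>j. g (Suc j) = (\<lambda>x. (3 * g j x - d (W j) x) / 2)"
    using choice[OF g(3)] by blast
  have partial: "f x = (\<Sum>j<n. (1/3) * (2/3)^j * d (W j) x) + (2/3)^n * g n x" for n x
  proof (induction n)
    case (Suc n)
    have "g n x = (1/3) * d (W n) x + (2/3) * g (Suc n) x" by (simp add: W(2) field_simps)
    then show ?case using Suc by (simp add: algebra_simps)
  qed (simp add: g(2))
  have "(\<lambda>j. (1/3) * (2/3)^j * d (W j) x) sums f x" for x
    unfolding sums_def
  proof (rule LIM_zero_cancel, rule Lim_null_comparison)
    show "(\<lambda>n. (2/3 :: real)^n) \<longlonglongrightarrow> 0" by (intro LIMSEQ_power_zero) simp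
    have "norm ((\<Sum>j<n. (1/3) * (2/3)^j * d (W j) x) - f x) \<le> (2/3)^n" for n
      using mult_left_mono[OF g(1)[of n x], of "(2/3)^n"] by (simp add: partial[of x n] abs_mult)
    then show "\<forall>\<^sub>F n in sequentially. norm ((\<Sum>j<n. (1/3) * (2/3)^j * d (W j) x) - f x) \<le> (2/3)^n"
      by simp
  qed
  then have "f x = digit_sum (\<lambda>j. x \<in> W j)" for x
    unfolding digit_sum_def d_def by (rule sums_unique)
  then show ?thesis using that W(1) by blast
qed

lemma decode_expansion:
  fixes f :: "'x \<Rightarrow>\<^sub>C complex"
  assumes "f \<in> cball 0 1"
  shows "\<exists>W. (\<forall>j. clopen (W j)) \<and> (\<forall>x. f x = decode (\<lambda>j. x \<in> W j))"
proof -
  have f: "cmod (f x) \<le> 1" for x using assms norm_bounded[of f x] by simp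
  have "continuous_on UNIV (\<lambda>x. Re (f x))" "continuous_on UNIV (\<lambda>x. Im (f x))"
    by (auto intro!: continuous_intros)
  moreover have "\<bar>Re (f x)\<bar> \<le> 1" "\<bar>Im (f x)\<bar> \<le> 1" for x
    using f[of x] abs_Re_le_cmod[of "f x"] abs_Im_le_cmod[of "f x"] by linarith+
  ultimately obtain U V :: "nat \<Rightarrow> 'x set" where
    U: "\<And>j. clopen (U j)" "\<And>x. Re (f x) = digit_sum (\<lambda>j. x \<in> U j)" and
    V: "\<And>j. clopen (V j)" "\<And>x. Im (f x) = digit_sum (\<lambda>j. x \<in> V j)"
    using digit_expansion[of "\<lambda>x. Re (f x)"] digit_expansion[of "\<lambda>x. Im (f x)"] by metis
  define W where "W j = (if even j then U (j div 2) else V (j div 2))" for j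
  have "f x = decode (\<lambda>j. x \<in> W j)" for x
    by (simp add: decode_def W_def complex_eq_iff U(2) V(2))
  moreover have "clopen (W j)" for j by (simp add: W_def U(1) V(1))
  ultimately show ?thesis by blast
qed

end

section \<open>Saturation of the algebra of continuous functions\<close>

lemma finite_set_star_poly: "finite (set_star_poly p)"
  by (induction p) auto

lemma finite_set_formula: "finite (set_formula \<phi>)"
  by (induction \<phi>) (auto simp: finite_set_star_poly)

lemma parameters_in_unit_ball: "\<phi> \<in> formulas \<Longrightarrow> set_formula \<phi> \<subseteq> cball 0 1"
  by (induction rule: formulas.induct) auto

lemma saturation_condition_finite:
  assumes "\<forall>n. formula_val (\<phi> n) b \<in> K n" "\<epsilon> > 0"
  shows "formula_val (\<phi> n) b \<in> nbhd (K n) \<epsilon>"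
proof -
  have "formula_val (\<phi> n) b \<in> K n" "dist (formula_val (\<phi> n) b) (formula_val (\<phi> n) b) < \<epsilon>"
    using assms by simp_all
  then show ?thesis unfolding nbhd_def by blast
qed

fun digit_index :: "nat + nat \<Rightarrow> nat \<Rightarrow> nat + nat" where
  "digit_index (Inl i) j = Inl (prod_encode (i, j))"
| "digit_index (Inr k) j = Inr (prod_encode (k, j))"

text \<open>
  The family \<open>C\<close> consists of the digits of all parameters and of all variables: the digits of the function with
  index \<open>i\<close> are the sets \<open>C (digit_index i j)\<close>.
\<close>

definition codes ::
    "(nat + nat \<Rightarrow> 'x set) \<Rightarrow> (nat \<Rightarrow> 'x::topological_space \<Rightarrow>\<^sub>C complex) \<Rightarrow> (nat \<Rightarrow> 'x \<Rightarrow>\<^sub>C complex) \<Rightarrow> bool"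
  where "codes C \<alpha> v \<longleftrightarrow> (\<forall>i x. case_sum \<alpha> v i x = decode (\<lambda>j. x \<in> C (digit_index i j)))"

lemma digit_index_bound: "\<exists>N. \<forall>i\<in>initial n. \<forall>j<l. digit_index i j \<in> initial N"
proof -
  have "finite (prod_encode ` ({..<n} \<times> {..<l}))" by simp
  then obtain N where "\<forall>m\<in>prod_encode ` ({..<n} \<times> {..<l}). m < N"
    using finite_nat_set_iff_bounded by blast
  then have "\<forall>i<n. \<forall>j<l. prod_encode (i, j) < N" by auto
  then have "\<forall>i\<in>initial n. \<forall>j<l. digit_index i j \<in> initial N" by (auto simp: initial_def)
  then show ?thesis ..
qed

context stone_space begin

lemma close_if_same_digit_patterns:
  fixes \<alpha> :: "nat \<Rightarrow> 'x \<Rightarrow>\<^sub>C complex"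
  shows "\<exists>N. \<forall>v w C D. codes C \<alpha> v \<longrightarrow> codes D \<alpha> w \<longrightarrow>
    patterns (initial N) C = patterns (initial N) D \<longrightarrow> close n \<alpha> v w"
proof -
  have pos: "(1/4::real)^n > 0" by simp
  obtain l where l: "\<And>s t. (\<And>j. j < l \<Longrightarrow> s j = t j) \<Longrightarrow> dist (decode s) (decode t) < (1/4)^n"
    using decode_uniformly_continuous[OF pos] by blast
  obtain N where N: "\<forall>i\<in>initial n. \<forall>j<l. digit_index i j \<in> initial N" using digit_index_bound by blast
  have near: "near n \<alpha> v x w y"
    if v: "codes C \<alpha> v"
      and w: "codes D \<alpha> w"
      and eq: "pattern (initial N) C x = pattern (initial N) D y" for v w C D x y
    unfolding near_def
  proof
    fix i assume i: "i \<in> initial n"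
    have "x \<in> C (digit_index i j) \<longleftrightarrow> y \<in> D (digit_index i j)" if "j < l" for j
    proof -
      have "digit_index i j \<in> initial N" using N i that by blast
      moreover have "digit_index i j \<in> pattern (initial N) C x \<longleftrightarrow> digit_index i j \<in> pattern (initial N) D y"
        using eq by simp
      ultimately show ?thesis by (simp add: pattern_def)
    qed
    then have "dist (case_sum \<alpha> v i x) (case_sum \<alpha> w i y) < (1/4)^n"
      unfolding v[unfolded codes_def, THEN spec, THEN spec] w[unfolded codes_def, THEN spec, THEN spec]
      by (rule l)
    then show "dist (case_sum \<alpha> v i x) (case_sum \<alpha> w i y) \<le> (1/4)^n" by simp
  qed
  have close: "close n \<alpha> v w"
    if v: "codes C \<alpha> v"
      and w: "codes D \<alpha> w"
      and eq: "patterns (initial N) C = patterns (initial N) D" for v w C D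
    unfolding close_def
  proof (intro conjI allI)
    fix x
    have "pattern (initial N) C x \<in> patterns (initial N) D" unfolding eq[symmetric] by (rule rangeI)
    then obtain y where "pattern (initial N) C x = pattern (initial N) D y" ..
    from near[OF v w this] show "\<exists>y. near n \<alpha> v x w y" ..
  next
    fix y
    have "pattern (initial N) D y \<in> patterns (initial N) C" unfolding eq by (rule rangeI)
    then obtain x where "pattern (initial N) D y = pattern (initial N) C x" ..
    from near[OF v w this[symmetric]] show "\<exists>x. near n \<alpha> v x w y" ..
  qed
  show ?thesis by (intro exI[of _ N] allI impI) (rule close)
qed

text \<open>
  The digits of the assignments \<open>b m\<close> have patterns with a limit that is realized by clopen sets
  \<open>V\<close>, and \<open>c\<close> is decoded from \<open>V\<close>. Decoding may produce values of modulus up to \<open>sqrt 2\<close>, but the values of \<open>c\<close>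
  are approximated by values of the \<open>b m\<close>, so they lie in the unit disc.
\<close>

lemma realize_functions:
  fixes \<alpha> :: "nat \<Rightarrow> 'x \<Rightarrow>\<^sub>C complex" and b :: "nat \<Rightarrow> nat \<Rightarrow> 'x \<Rightarrow>\<^sub>C complex"
  assumes sat: "countably_degree_1_saturated TYPE('x \<Rightarrow>\<^sub>C complex)"
    and iso: "isolated_points = ({} :: 'x set)"
    and \<alpha>: "\<And>i. \<alpha> i \<in> cball 0 1" and b: "\<And>m. assignment (b m)"
  obtains c where "assignment c" "\<And>n. \<exists>m\<ge>n. close n \<alpha> c (b m)"
proof -
  have "\<forall>f :: 'x \<Rightarrow>\<^sub>C complex. \<exists>W :: nat \<Rightarrow> 'x set. f \<in> cball 0 1 \<longrightarrow>
      (\<forall>j. clopen (W j)) \<and> (\<forall>x. apply_bcontfun f x = decode (\<lambda>j. x \<in> W j))"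
    using decode_expansion by blast
  from choice[OF this] obtain code :: "('x \<Rightarrow>\<^sub>C complex) \<Rightarrow> nat \<Rightarrow> 'x set" where
    code: "\<And>f j. f \<in> cball 0 1 \<Longrightarrow> clopen (code f j)"
      "\<And>f x. f \<in> cball 0 1 \<Longrightarrow> apply_bcontfun f x = decode (\<lambda>j. x \<in> code f j)" by blast
  define digits :: "(nat \<Rightarrow> 'x \<Rightarrow>\<^sub>C complex) \<Rightarrow> nat \<Rightarrow> 'x set"
    where "digits f i = (case prod_decode i of (k, j) \<Rightarrow> code (f k) j)" for f i
  have digits: "clopen (digits f i)" if "assignment f" for f i
    using code(1) that by (auto simp: digits_def split: prod.split)
  have digits_encode: "digits f (prod_encode (k, j)) = code (f k) j" for f k j
    by (simp add: digits_def)
  have no_iso: "{p} \<in> range (digits \<alpha>)" if "p \<in> isolated_points" for p :: 'x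
    using that iso by simp
  have fin: "finite (isolated_points :: 'x set)" using iso by simp
  have "assignment \<alpha>" using \<alpha> by simp
  then have clop: "clopen (digits \<alpha> i)" "clopen (digits (b m) k)" for i m k
    using digits digits[OF b] by simp_all
  obtain V where V: "\<And>k. clopen (V k)" "\<And>n. \<exists>m\<ge>n. patterns (initial n) (case_sum (digits \<alpha>) V) =
      patterns (initial n) (case_sum (digits \<alpha>) (digits (b m)))"
    using realize_patterns[of "digits \<alpha>" "\<lambda>m. digits (b m)", OF sat fin no_iso clop] by blast
  have "\<forall>k. \<exists>f. apply_bcontfun f = (\<lambda>x. decode (\<lambda>j. x \<in> V (prod_encode (k, j))))"
  proof
    fix k
    have "continuous_on UNIV (\<lambda>x. decode (\<lambda>j. x \<in> V (prod_encode (k, j))))"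
      by (rule continuous_decode) (rule V(1))
    then obtain f where "apply_bcontfun f = (\<lambda>x. decode (\<lambda>j. x \<in> V (prod_encode (k, j))))"
      by (rule bcontfun_of_continuous)
    then show "\<exists>f. apply_bcontfun f = (\<lambda>x. decode (\<lambda>j. x \<in> V (prod_encode (k, j))))" ..
  qed
  from choice[OF this] obtain c where
    "\<forall>k. apply_bcontfun (c k) = (\<lambda>x. decode (\<lambda>j. x \<in> V (prod_encode (k, j))))" ..
  then have c: "c k x = decode (\<lambda>j. x \<in> V (prod_encode (k, j)))" for k x by simp
  have code_c: "codes (case_sum (digits \<alpha>) V) \<alpha> c"
    unfolding codes_def
  proof (intro allI)
    show "case_sum \<alpha> c i x = decode (\<lambda>j. x \<in> case_sum (digits \<alpha>) V (digit_index i j))" for i x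
      using code(2)[OF \<alpha>] by (cases i) (simp_all add: c digits_encode)
  qed
  have code_b: "codes (case_sum (digits \<alpha>) (digits (b m))) \<alpha> (b m)" for m
    unfolding codes_def
  proof (intro allI)
    show "case_sum \<alpha> (b m) i x =
        decode (\<lambda>j. x \<in> case_sum (digits \<alpha>) (digits (b m)) (digit_index i j))" for i x
      using code(2)[OF \<alpha>] code(2)[OF b[THEN spec]] by (cases i) (simp_all add: digits_encode)
  qed
  have close: "\<exists>m\<ge>n. close n \<alpha> c (b m)" for n
  proof -
    obtain N where N: "\<And>v w C D. codes C \<alpha> v \<Longrightarrow> codes D \<alpha> w \<Longrightarrow>
      patterns (initial N) C = patterns (initial N) D \<Longrightarrow> close n \<alpha> v w"
      using close_if_same_digit_patterns[of \<alpha> n] by blast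
    obtain m where m: "m \<ge> max n N" "patterns (initial (max n N)) (case_sum (digits \<alpha>) V) =
      patterns (initial (max n N)) (case_sum (digits \<alpha>) (digits (b m)))"
      using V(2) by blast
    have "close n \<alpha> c (b m)"
      by (rule N[OF code_c code_b patterns_initial_mono[OF m(2)]]) simp
    then show ?thesis using m(1) by auto
  qed
  have "c k \<in> cball 0 1" for k :: nat
  proof -
    have "cmod (c k x) \<le> 1" for x
    proof (rule field_le_epsilon)
      fix \<epsilon> :: real assume "\<epsilon> > 0"
      then obtain n where n: "(1/4::real)^n \<le> \<epsilon>" "n > k" using small_power by blast
      obtain m where "close n \<alpha> c (b m)" using close by blast
      then obtain y where y: "near n \<alpha> c x (b m) y" unfolding close_def by blast
      have "Inr k \<in> initial n" using n(2) by (simp add: initial_def)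
      from y[unfolded near_def, THEN bspec, OF this] have "dist (c k x) (b m k y) \<le> (1/4)^n" by simp
      moreover have "cmod (b m k y) \<le> 1"
        using b[of m, THEN spec, of k] norm_bounded[of "b m k" y] by simp
      ultimately show "cmod (c k x) \<le> 1 + \<epsilon>"
        using n(1) norm_triangle_ineq2[of "c k x" "b m k y"] by (simp add: dist_norm)
    qed
    then have "norm (c k) \<le> 1" by (rule norm_bound)
    then show ?thesis by simp
  qed
  then have "assignment c" by simp
  then show ?thesis by (rule that[of c, OF _ close])
qed

text \<open>
  Approximate solutions \<open>b m\<close> of the first \<open>m\<close> conditions have a limit \<open>c\<close> in the sense of joint ranges.
  By \<open>has_modulus_formula\<close>, the values of each formula at \<open>c\<close> are limits of its values at the \<open>b m\<close>.
\<close>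

lemma countably_saturated_if_degree_1:
  assumes sat: "countably_degree_1_saturated TYPE('x \<Rightarrow>\<^sub>C complex)"
    and iso: "isolated_points = ({} :: 'x set)"
  shows "countably_saturated TYPE('x \<Rightarrow>\<^sub>C complex)"
  unfolding countably_saturated_def countably_saturated_for_def
proof (intro allI impI iffI)
  fix \<phi> :: "nat \<Rightarrow> ('x \<Rightarrow>\<^sub>C complex) formula" and K :: "nat \<Rightarrow> real set" and \<epsilon> :: real and \<Delta> :: "nat set"
  assume "\<exists>b. assignment b \<and> (\<forall>n. formula_val (\<phi> n) b \<in> K n)" and \<epsilon>: "\<epsilon> > 0"
  then obtain b where b: "assignment b" "\<forall>n. formula_val (\<phi> n) b \<in> K n" by blast
  have "\<forall>n\<in>\<Delta>. formula_val (\<phi> n) b \<in> nbhd (K n) \<epsilon>"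
    using saturation_condition_finite[OF b(2) \<epsilon>] ..
  then show "\<exists>b. assignment b \<and> (\<forall>n\<in>\<Delta>. formula_val (\<phi> n) b \<in> nbhd (K n) \<epsilon>)" using b(1) by blast
next
  fix \<phi> :: "nat \<Rightarrow> ('x \<Rightarrow>\<^sub>C complex) formula" and K :: "nat \<Rightarrow> real set"
  assume \<phi>: "\<forall>n. \<phi> n \<in> formulas" and K: "\<forall>n. compact (K n)"
    and fs: "\<forall>\<epsilon>>0. \<forall>\<Delta>. finite \<Delta> \<longrightarrow>
      (\<exists>b. assignment b \<and> (\<forall>n\<in>\<Delta>. formula_val (\<phi> n) b \<in> nbhd (K n) \<epsilon>))"
  define A where "A = insert 0 (\<Union>n. set_formula (\<phi> n))"
  have "countable (\<Union>n. set_formula (\<phi> n))"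
    by (rule countable_UN) (simp_all add: countable_finite finite_set_formula)
  then have "countable A" by (simp add: A_def)
  define \<alpha> where "\<alpha> = from_nat_into A"
  have range_\<alpha>: "range \<alpha> = A"
    unfolding \<alpha>_def using \<open>countable A\<close> by (intro range_from_nat_into) (simp_all add: A_def)
  have "A \<subseteq> cball 0 1"
    unfolding A_def using parameters_in_unit_ball[OF \<phi>[THEN spec]] by auto
  then have \<alpha>: "\<alpha> i \<in> cball 0 1" for i using range_\<alpha> by blast
  have "\<forall>m. \<exists>b. assignment b \<and> (\<forall>n\<in>{..m}. formula_val (\<phi> n) b \<in> nbhd (K n) ((1/4)^m))"
    using fs by simp
  from choice[OF this] obtain b where
    "\<forall>m. assignment (b m) \<and> (\<forall>n\<in>{..m}. formula_val (\<phi> n) (b m) \<in> nbhd (K n) ((1/4)^m))" ..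
  then have b: "assignment (b m)"
    "n \<le> m \<Longrightarrow> formula_val (\<phi> n) (b m) \<in> nbhd (K n) ((1/4)^m)" for m n
    by simp_all
  obtain c where c: "assignment c" "\<And>n. \<exists>m\<ge>n. close n \<alpha> c (b m)"
    using realize_functions[of \<alpha> b, OF sat iso \<alpha> b(1)] by blast
  have "formula_val (\<phi> n) c \<in> K n" for n
  proof -
    have "\<exists>z\<in>K n. dist z (formula_val (\<phi> n) c) < \<epsilon>" if "\<epsilon> > 0" for \<epsilon>
    proof -
      have half: "\<epsilon> / 2 > 0" using that by simp
      have "has_modulus \<alpha> (formula_val (\<phi> n))"
        by (rule has_modulus_formula[OF iso \<phi>[THEN spec]]) (auto simp: range_\<alpha> A_def)
      then obtain l where l: "\<And>v w. assignment v \<Longrightarrow> assignment w \<Longrightarrow> close l \<alpha> v w \<Longrightarrow>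
          \<bar>formula_val (\<phi> n) v - formula_val (\<phi> n) w\<bar> \<le> \<epsilon> / 2"
        using half unfolding has_modulus_def by blast
      obtain k where k: "(1/4::real)^k \<le> \<epsilon> / 2" "k > max l n" using small_power[OF half] by blast
      obtain m where m: "m \<ge> k" "close k \<alpha> c (b m)" using c(2) by blast
      have "l \<le> k" "n \<le> m" using k(2) m(1) by simp_all
      have 1: "\<bar>formula_val (\<phi> n) c - formula_val (\<phi> n) (b m)\<bar> \<le> \<epsilon> / 2"
        by (rule l[OF c(1) b(1) close_mono[OF m(2) \<open>l \<le> k\<close>]])
      obtain z where z: "z \<in> K n" "dist (formula_val (\<phi> n) (b m)) z < (1/4)^m"
        using b(2)[OF \<open>n \<le> m\<close>] unfolding nbhd_def by blast
      have "(1/4::real)^m \<le> (1/4)^k" using m(1) by (intro power_decreasing) auto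
      then have "dist z (formula_val (\<phi> n) c) < \<epsilon>"
        using 1 z(2) k(1) unfolding dist_real_def by linarith
      then show ?thesis using z(1) by blast
    qed
    then show ?thesis using closed_approachable[OF compact_imp_closed[OF K[THEN spec, of n]], of "formula_val (\<phi> n) c"] by simp
  qed
  then show "\<exists>b. assignment b \<and> (\<forall>n. formula_val (\<phi> n) b \<in> K n)" using c(1) by blast
qed

end

text \<open>
  A parameter \<open>a\<close> is \<open>\<parallel>a\<parallel>\<close> times an element of the unit ball, and scalars are unrestricted.
\<close>

lemma star_poly_with_unit_parameters:
  "\<exists>p'. set_star_poly p' \<subseteq> cball 0 1 \<and> (\<forall>v. poly_val v p' = poly_val v p)"
  for p :: "'a::cstar_algebra star_poly"
proof (induction p)
  case (PVar k)
  show ?case by (intro exI[of _ "PVar k"]) simp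
next
  case (PParam a)
  let ?p = "PMult (PScalar (complex_of_real (norm a))) (PParam (a /\<^sub>R norm a))"
  have "set_star_poly ?p \<subseteq> cball 0 1" by (cases "a = 0") simp_all
  moreover have "poly_val v ?p = poly_val v (PParam a)" for v
    by (cases "a = 0") (simp_all add: scaleC_of_real)
  ultimately show ?case by blast
next
  case (PScalar c)
  show ?case by (intro exI[of _ "PScalar c"]) simp
next
  case (PAdd p q)
  then obtain p' q' where "set_star_poly p' \<subseteq> cball 0 1" "\<forall>v. poly_val v p' = poly_val v p"
    "set_star_poly q' \<subseteq> cball 0 1" "\<forall>v. poly_val v q' = poly_val v q" by blast
  then show ?case by (intro exI[of _ "PAdd p' q'"]) simp
next
  case (PMult p q)
  then obtain p' q' where "set_star_poly p' \<subseteq> cball 0 1" "\<forall>v. poly_val v p' = poly_val v p"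
    "set_star_poly q' \<subseteq> cball 0 1" "\<forall>v. poly_val v q' = poly_val v q" by blast
  then show ?case by (intro exI[of _ "PMult p' q'"]) simp
next
  case (PStar p)
  then obtain p' where "set_star_poly p' \<subseteq> cball 0 1" "\<forall>v. poly_val v p' = poly_val v p" by blast
  then show ?case by (intro exI[of _ "PStar p'"]) simp
qed

lemma degree_1_saturated_if_countably_saturated:
  assumes "countably_saturated TYPE('a::cstar_algebra)"
  shows "countably_degree_1_saturated TYPE('a)"
  unfolding countably_degree_1_saturated_def countably_saturated_for_def
proof (intro allI impI)
  fix \<phi> :: "nat \<Rightarrow> 'a formula" and K :: "nat \<Rightarrow> real set"
  assume \<phi>: "\<forall>n. \<phi> n \<in> FNorm ` degree_1_polys" and K: "\<forall>n. compact (K n)"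
  have "\<exists>\<psi>. \<psi> \<in> formulas \<and> formula_val \<psi> = formula_val (\<phi> n)" for n
  proof -
    obtain p where p: "\<phi> n = FNorm p" using \<phi> by blast
    obtain p' where "set_star_poly p' \<subseteq> cball 0 1" "\<forall>v. poly_val v p' = poly_val v p"
      using star_poly_with_unit_parameters by blast
    then show ?thesis by (intro exI[of _ "FNorm p'"]) (simp add: p formulas.intros(1))
  qed
  then obtain \<psi> where \<psi>: "\<And>n. \<psi> n \<in> formulas" "\<And>n. formula_val (\<psi> n) = formula_val (\<phi> n)" by metis
  show "(\<exists>b. assignment b \<and> (\<forall>n. formula_val (\<phi> n) b \<in> K n)) \<longleftrightarrow>
    (\<forall>\<epsilon>>0. \<forall>\<Delta>. finite \<Delta> \<longrightarrow>
      (\<exists>b. assignment b \<and> (\<forall>n\<in>\<Delta>. formula_val (\<phi> n) b \<in> nbhd (K n) \<epsilon>)))"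
    using assms[unfolded countably_saturated_def countably_saturated_for_def,
        THEN spec, THEN spec, THEN mp, THEN mp, of \<psi> K] \<psi>(1) K
    unfolding \<psi>(2) by blast
qed

theorem theorem5p14:
  assumes "compact (UNIV :: 'x::t2_space set)"
    and "infinite (UNIV :: 'x set)"
    and "zero_dimensional TYPE('x)"
    and "finite (isolated_points :: 'x set)"
  shows "(countably_degree_1_saturated TYPE('x \<Rightarrow>\<^sub>C complex) \<longrightarrow>
            ba_countably_saturated TYPE('x clopens))
       \<and> ((isolated_points :: 'x set) = {} \<longrightarrow>
            (countably_degree_1_saturated TYPE('x \<Rightarrow>\<^sub>C complex) \<longleftrightarrow>
             countably_saturated TYPE('x \<Rightarrow>\<^sub>C complex)))"
proof -
  interpret stone_space "TYPE('x)" using assms(1,3) by unfold_locales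
  show ?thesis
    using ba_countably_saturated_clopens[OF _ assms(4)] countably_saturated_if_degree_1
      degree_1_saturated_if_countably_saturated by blast
qed

end
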